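(* For any integer $\ell\ge1$ and any constant $0<c<\frac{1}{3\ell}$, we have, as $n\to\infty$, \[g(n;2\ell+1,cn)\ge\left(\frac{\ell-1}{\ell}+c+o(1)\right)\frac{n^2}{2}.\]
   Context: A red/blue/purple colouring of $K_n$ is a partition $R\cup B\cup P$ of its edge set. For integers $s,t\ge2$ and $n<R(s,t)$, $g(n;s,t)$ is the largest integer $g$ such that some red/blue/purple colouring of $K_n$ has $|P|=g$, $R\cup P$ is $K_s$-free and $B\cup P$ is $K_t$-free; for non-integer arguments $g(n;s,t):=g(n;\lceil s\rceil,\lceil t\rceil)$. *)

theory Defs
  imports Complex_Main "HOL-Library.Ramsey" "HOL-Library.Landau_Symbols"
begin

definition ramsey_number :: "nat \<Rightarrow> nat \<Rightarrow> nat" where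
  "ramsey_number s t = (LEAST r. partn_lst {..<r} [s, t] 2)"

text \<open>The complete graph on \<open>n\<close> vertices has vertex set \<open>{..<n}\<close> and edge set \<open>[{..<n}]\<^bsup>2\<^esup>\<close>.\<close>

definition rbp_colouring :: "nat \<Rightarrow> nat set set \<Rightarrow> nat set set \<Rightarrow> nat set set \<Rightarrow> bool" where
  "rbp_colouring n R B P \<longleftrightarrow>
     R \<union> B \<union> P = [{..<n}]\<^bsup>2\<^esup> \<and> R \<inter> B = {} \<and> R \<inter> P = {} \<and> B \<inter> P = {}"

definition K_free :: "nat \<Rightarrow> nat \<Rightarrow> nat set set \<Rightarrow> bool" where
  "K_free n s E \<longleftrightarrow> \<not> (\<exists>S \<subseteq> {..<n}. card S = s \<and> clique S E)"

definition purple_counts :: "nat \<Rightarrow> nat \<Rightarrow> nat \<Rightarrow> nat set" where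
  "purple_counts n s t =
     {card P | R B P. rbp_colouring n R B P \<and> K_free n s (R \<union> P) \<and> K_free n t (B \<union> P)}"

text \<open>Meaningful only for \<open>n < ramsey_number s t\<close>, which is exactly the case in which the
  maximum is over a nonempty set (see \<open>purple_counts_nonempty_iff\<close> below).\<close>

definition g :: "nat \<Rightarrow> nat \<Rightarrow> nat \<Rightarrow> nat" where
  "g n s t = Max (purple_counts n s t)"

definition g_real :: "nat \<Rightarrow> real \<Rightarrow> real \<Rightarrow> nat" where
  "g_real n s t = g n (nat \<lceil>s\<rceil>) (nat \<lceil>t\<rceil>)"

lemma finite_purple_counts: "finite (purple_counts n s t)"
proof (rule finite_subset)
  show "purple_counts n s t \<subseteq> card ` Pow ([{..<n}]\<^bsup>2\<^esup>)"
    unfolding purple_counts_def rbp_colouring_def by blast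
  show "finite (card ` Pow ([{..<n}]\<^bsup>2\<^esup>))"
    by (simp add: finite_imp_finite_nsets)
qed

lemma less_ramsey_number_iff: "n < ramsey_number s t \<longleftrightarrow> \<not> partn_lst {..<n} [s, t] 2"
proof -
  have "partn_lst {..<ramsey_number s t} [s, t] 2"
    unfolding ramsey_number_def by (rule LeastI, rule ramsey2_full)
  then show ?thesis
    using not_less_Least[of n "\<lambda>r. partn_lst {..<r} [s, t] 2"]
      partn_lst_greater_resource[of "ramsey_number s t" "[s, t]" 2 n]
    unfolding ramsey_number_def by (meson linorder_not_less)
qed

lemma clique_iff_nsets: "clique S E \<longleftrightarrow> [S]\<^bsup>2\<^esup> \<subseteq> E"
proof
  assume S: "clique S E"
  show "[S]\<^bsup>2\<^esup> \<subseteq> E"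
  proof
    fix e assume "e \<in> [S]\<^bsup>2\<^esup>"
    then have "e \<subseteq> S" "card e = 2"
      by (simp_all add: nsets_def)
    then obtain v w where "e = {v, w}" "v \<noteq> w"
      by (auto simp: card_2_iff)
    then show "e \<in> E"
      using S \<open>e \<subseteq> S\<close> unfolding clique_def by simp
  qed
next
  assume S: "[S]\<^bsup>2\<^esup> \<subseteq> E"
  show "clique S E"
    unfolding clique_def
  proof (intro ballI impI)
    fix v w assume "v \<in> S" "w \<in> S" "v \<noteq> w"
    then have "{v, w} \<in> [S]\<^bsup>2\<^esup>"
      by (simp add: nsets_def)
    then show "{v, w} \<in> E"
      by (rule subsetD[OF S])
  qed
qed

lemma purple_counts_nonempty_iff:
  "purple_counts n s t \<noteq> {} \<longleftrightarrow> n < ramsey_number s t"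
proof
  assume "purple_counts n s t \<noteq> {}"
  then obtain R B P where RBP: "rbp_colouring n R B P" "K_free n s (R \<union> P)" "K_free n t (B \<union> P)"
    unfolding purple_counts_def by blast
  define f :: "nat set \<Rightarrow> nat" where "f e = (if e \<in> R \<union> P then 0 else 1)" for e
  have "\<not> partn_lst {..<n} [s, t] 2"
  proof
    assume "partn_lst {..<n} [s, t] 2"
    moreover have "f \<in> [{..<n}]\<^bsup>2\<^esup> \<rightarrow> {..<length [s, t]}"
      by (auto simp: f_def)
    ultimately obtain i where i: "i < length [s, t]" "monochromatic {..<n} ([s, t] ! i) 2 f i"
      unfolding partn_lst_def by blast
    then obtain H where H: "H \<in> nsets {..<n} ([s, t] ! i)" "f ` nsets H 2 \<subseteq> {i}"
      unfolding monochromatic_def by blast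
    have Hsub: "H \<subseteq> {..<n}" "card H = [s, t] ! i"
      using H(1) by (auto simp: nsets_def)
    have H2: "[H]\<^bsup>2\<^esup> \<subseteq> R \<union> B \<union> P"
      using RBP(1) nsets_mono[OF Hsub(1), of 2] unfolding rbp_colouring_def by simp
    have "i = 0 \<or> i = 1"
      using i(1) by (simp add: less_Suc_eq)
    then consider "i = 0" | "i = 1"
      by blast
    then show False
    proof cases
      case 1
      have "[H]\<^bsup>2\<^esup> \<subseteq> R \<union> P"
      proof
        fix e assume "e \<in> [H]\<^bsup>2\<^esup>"
        then have "f e = 0" using H(2) 1 by blast
        then show "e \<in> R \<union> P" unfolding f_def by (simp split: if_splits)
      qed
      then show False
        using RBP(2) Hsub 1 unfolding K_free_def clique_iff_nsets by auto
    next
      case 2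
      have "[H]\<^bsup>2\<^esup> \<subseteq> B \<union> P"
      proof
        fix e assume e: "e \<in> [H]\<^bsup>2\<^esup>"
        then have "f e = 1" using H(2) 2 by blast
        then have "e \<notin> R \<union> P" unfolding f_def by (simp split: if_splits)
        then show "e \<in> B \<union> P" using e H2 by blast
      qed
      then show False
        using RBP(3) Hsub 2 unfolding K_free_def clique_iff_nsets by auto
    qed
  qed
  then show "n < ramsey_number s t"
    by (simp add: less_ramsey_number_iff)
next
  assume "n < ramsey_number s t"
  then obtain f where f: "f \<in> [{..<n}]\<^bsup>2\<^esup> \<rightarrow> {..<length [s, t]}"
      "\<And>i. i < length [s, t] \<Longrightarrow> \<not> monochromatic {..<n} ([s, t] ! i) 2 f i"
    unfolding less_ramsey_number_iff partn_lst_def by blast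
  define R where "R = {e \<in> [{..<n}]\<^bsup>2\<^esup>. f e = 0}"
  define B where "B = {e \<in> [{..<n}]\<^bsup>2\<^esup>. f e = 1}"
  have "rbp_colouring n R B {}"
  proof -
    have "f e = 0 \<or> f e = 1" if "e \<in> [{..<n}]\<^bsup>2\<^esup>" for e
      using funcset_mem[OF f(1) that] by (simp add: less_Suc_eq)
    then have "R \<union> B = [{..<n}]\<^bsup>2\<^esup>"
      unfolding R_def B_def by blast
    moreover have "R \<inter> B = {}"
      unfolding R_def B_def by (simp add: disjoint_iff)
    ultimately show ?thesis
      unfolding rbp_colouring_def by simp
  qed
  moreover have "K_free n s (R \<union> {})"
  proof -
    have "f ` nsets S 2 \<subseteq> {0} \<and> S \<in> [{..<n}]\<^bsup>s\<^esup>"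
      if S: "S \<subseteq> {..<n}" "card S = s" "[S]\<^bsup>2\<^esup> \<subseteq> R" for S
    proof
      show "f ` nsets S 2 \<subseteq> {0}"
      proof (rule image_subsetI)
        fix e assume "e \<in> [S]\<^bsup>2\<^esup>"
        then have "e \<in> R" by (rule subsetD[OF S(3)])
        then show "f e \<in> {0}" by (simp add: R_def)
      qed
      show "S \<in> [{..<n}]\<^bsup>s\<^esup>"
        using S(1,2) finite_subset[OF S(1)] by (simp add: nsets_def)
    qed
    then have *: "monochromatic {..<n} s 2 f 0"
      if "S \<subseteq> {..<n}" "card S = s" "[S]\<^bsup>2\<^esup> \<subseteq> R" for S
      using that unfolding monochromatic_def by (intro bexI[of _ S]) simp_all
    have "\<not> monochromatic {..<n} s 2 f 0"
      using f(2)[of 0] by simp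
    then show ?thesis
      unfolding K_free_def clique_iff_nsets Un_empty_right by (auto dest: *)
  qed
  moreover have "K_free n t (B \<union> {})"
  proof -
    have "f ` nsets S 2 \<subseteq> {1} \<and> S \<in> [{..<n}]\<^bsup>t\<^esup>"
      if S: "S \<subseteq> {..<n}" "card S = t" "[S]\<^bsup>2\<^esup> \<subseteq> B" for S
    proof
      show "f ` nsets S 2 \<subseteq> {1}"
      proof (rule image_subsetI)
        fix e assume "e \<in> [S]\<^bsup>2\<^esup>"
        then have "e \<in> B" by (rule subsetD[OF S(3)])
        then show "f e \<in> {1}" by (simp add: B_def)
      qed
      show "S \<in> [{..<n}]\<^bsup>t\<^esup>"
        using S(1,2) finite_subset[OF S(1)] by (simp add: nsets_def)
    qed
    then have *: "monochromatic {..<n} t 2 f 1"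
      if "S \<subseteq> {..<n}" "card S = t" "[S]\<^bsup>2\<^esup> \<subseteq> B" for S
      using that unfolding monochromatic_def by (intro bexI[of _ S]) simp_all
    have "\<not> monochromatic {..<n} t 2 f 1"
      using f(2)[of 1] by simp
    then show ?thesis
      unfolding K_free_def clique_iff_nsets Un_empty_right by (auto dest: *)
  qed
  ultimately show "purple_counts n s t \<noteq> {}"
    unfolding purple_counts_def by blast
qed

end

theory Submission
  imports Defs "HOL-Library.Countable" "HOL-Computational_Algebra.Primes"
begin

text \<open>Neighbourhoods in a triangle-free graph are independent, so the extremal objects are
  triangle-free graphs, with vertex weights, whose weighted degrees all equal the weighted
  independence number. The ratio of degree to total weight takes every rational value in
  \<open>(1/4, 1/3]\<close> on bicirculant graphs, and the weighted Mycielskian turns a ratio \<open>c\<close> into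
  \<open>c / (1 + c\<^sup>2)\<close>, so the ratios are dense in \<open>(0, 1/3)\<close>. Joining \<open>l\<close> copies of such a graph of ratio
  slightly below \<open>c l\<close> gives a graph without a clique of size \<open>2 l + 1\<close>, with relative
  independence number below \<open>c\<close> and edge density close to \<open>(l - 1) / l + c\<close>. In a blow-up, colour a sparse set of edges
  red so that every two linear-sized sets in adjacent classes span a red edge, the remaining edges
  purple, and the non-edges blue. A clique avoiding red then is large only in an independent set
  of classes.\<close>

subsection \<open>Graphs with degree equal to independence number\<close>

text \<open>The join of \<open>l\<close> copies has density \<open>(l - 1) / l\<close> plus its
  relative degree inside one copy, while the size of blue/purple cliques is governed by the relative
  independence number. In a triangle-free graph the degree never exceeds the independence number, so
  this construction reaches the bound only when the two agree. Without red edges the whole vertex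
  set would be a blue/purple clique. Every adjacent pair of classes therefore needs red, at a cost
  of an arbitrarily small proportion of its edges; this forces sparse relations that still meet all
  large rectangles. Such relations and the rounding of class sizes both use up a positive proportion
  of the independence budget, so the ratio must stay strictly below \<open>c l\<close>. The deficit
  goes into the error term, which is why density of the ratios is the right target. The bounds 1/4
  and 1/3 are exactly the conditions under which the two radii of a bicirculant satisfy
  \<open>0 \<le> s \<le> t\<close>. Since \<open>c / (1 + c\<^sup>2)\<close> sends 1/3 to 3/10,
  above 1/4, the Mycielskian images overlap the bicirculant range and no gap remains below
  it.\<close>

text \<open>The triangle clause does not ask for distinct vertices, so \<open>x = y = z\<close> also
  excludes loops. Weights are naturals because they later become numbers of twin vertices.\<close>

definition tight_graph :: "'a set \<Rightarrow> ('a \<Rightarrow> 'a \<Rightarrow> bool) \<Rightarrow> ('a \<Rightarrow> nat) \<Rightarrow> nat \<Rightarrow> bool" where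
  "tight_graph V E w d \<longleftrightarrow>
     finite V \<and> (\<forall>x y. E x y \<longrightarrow> E y x) \<and>
     (\<forall>x\<in>V. \<forall>y\<in>V. \<forall>z\<in>V. \<not> (E x y \<and> E y z \<and> E x z)) \<and>
     (\<forall>x\<in>V. sum w {y \<in> V. E x y} = d) \<and>
     (\<forall>S\<subseteq>V. (\<forall>x\<in>S. \<forall>y\<in>S. \<not> E x y) \<longrightarrow> sum w S \<le> d)"

text \<open>Fixing the vertex type to \<open>nat\<close> makes this a predicate of the number alone,
  which can be iterated although the Mycielskian changes the vertex type;
  \<open>tight_ratioI\<close> returns to \<open>nat\<close> by relabelling.\<close>

definition tight_ratio :: "real \<Rightarrow> bool" where
  "tight_ratio c \<longleftrightarrow> (\<exists>(V :: nat set) E w d.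
     tight_graph V E w d \<and> sum w V > 0 \<and> c = real d / real (sum w V))"

lemma tight_graphD:
  assumes "tight_graph V E w d"
  shows "finite V" and "E x y \<Longrightarrow> E y x"
    and "x \<in> V \<Longrightarrow> y \<in> V \<Longrightarrow> z \<in> V \<Longrightarrow> E x y \<Longrightarrow> E y z \<Longrightarrow> \<not> E x z"
    and "x \<in> V \<Longrightarrow> sum w {y \<in> V. E x y} = d"
    and "S \<subseteq> V \<Longrightarrow> (\<And>x y. x \<in> S \<Longrightarrow> y \<in> S \<Longrightarrow> \<not> E x y) \<Longrightarrow> sum w S \<le> d"
proof -
  note * = assms[unfolded tight_graph_def]
  show "finite V" using * by (rule conjunct1)
  show "E y x" if "E x y" using *[THEN conjunct2, THEN conjunct1] that by iprover
  show "\<not> E x z" if "x \<in> V" "y \<in> V" "z \<in> V" "E x y" "E y z"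
    using *[THEN conjunct2, THEN conjunct2, THEN conjunct1] that by (metis (no_types))
  show "sum w {y \<in> V. E x y} = d" if "x \<in> V"
    using *[THEN conjunct2, THEN conjunct2, THEN conjunct2, THEN conjunct1] that by (rule bspec)
  show "sum w S \<le> d" if "S \<subseteq> V" "\<And>x y. x \<in> S \<Longrightarrow> y \<in> S \<Longrightarrow> \<not> E x y"
    using *[THEN conjunct2, THEN conjunct2, THEN conjunct2, THEN conjunct2] that by (metis (no_types))
qed

lemma tight_ratioI:
  fixes V :: "'a::countable set"
  assumes G: "tight_graph V E w d" and pos: "sum w V > 0"
  shows "tight_ratio (real d / real (sum w V))"
proof -
  define V' where "V' = (to_nat :: 'a \<Rightarrow> nat) ` V"
  define E' where "E' x y \<longleftrightarrow> E (from_nat x) (from_nat y)" for x y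
  define w' where "w' x = w (from_nat x :: 'a)" for x
  have inj: "inj_on (to_nat :: 'a \<Rightarrow> nat) A" for A
    by (simp add: inj_on_def)
  have sum': "sum w' (to_nat ` A) = sum w A" for A :: "'a set"
    by (simp add: sum.reindex[OF inj] w'_def)
  have "tight_graph V' E' w' d"
    unfolding tight_graph_def
  proof (intro conjI allI ballI impI)
    show "finite V'" using tight_graphD(1)[OF G] by (simp add: V'_def)
    show "E' y x" if "E' x y" for x y
      using tight_graphD(2)[OF G] that unfolding E'_def by blast
    show "\<not> (E' x y \<and> E' y z \<and> E' x z)" if "x \<in> V'" "y \<in> V'" "z \<in> V'" for x y z
    proof -
      from that obtain x' y' z' where "x' \<in> V" "y' \<in> V" "z' \<in> V"
        "x = to_nat x'" "y = to_nat y'" "z = to_nat z'" unfolding V'_def by blast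
      then show ?thesis using tight_graphD(3)[OF G, of x' y' z'] by (auto simp: E'_def)
    qed
    show "sum w' {y \<in> V'. E' x y} = d" if x: "x \<in> V'" for x
    proof -
      obtain v where v: "v \<in> V" "x = to_nat v" using x by (auto simp: V'_def)
      have "{y \<in> V'. E' x y} = to_nat ` {y \<in> V. E v y}"
        using v by (auto simp: V'_def E'_def)
      then show ?thesis using tight_graphD(4)[OF G v(1)] by (simp add: sum')
    qed
    show "sum w' S \<le> d" if S: "S \<subseteq> V'" "\<forall>x\<in>S. \<forall>y\<in>S. \<not> E' x y" for S
    proof -
      obtain A where A: "A \<subseteq> V" "S = to_nat ` A"
        using S(1) unfolding V'_def by (meson subset_imageE)
      have "\<not> E x y" if "x \<in> A" "y \<in> A" for x y using S(2) A that by (simp add: E'_def)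
      then show ?thesis using tight_graphD(5)[OF G A(1)] A(2) by (simp add: sum')
    qed
  qed
  moreover have "sum w' V' = sum w V" by (simp add: V'_def sum')
  ultimately show ?thesis
    unfolding tight_ratio_def using pos 
    by (intro exI[of _ V'] exI[of _ E'] exI[of _ w'] exI[of _ d] conjI) (simp_all only:)
qed

subsection \<open>Bicirculant graphs\<close>

text \<open>Lengthening the interval by one adds the translate by 1 of the sumset. If this yields
  nothing new, the sumset is closed under adding 1 modulo \<open>N\<close> and is everything;
  otherwise it gains an element.\<close>

lemma card_cyclic_sumset_interval:
  fixes N :: int
  assumes N: "N > 0" and S: "S \<subseteq> {0..<N}" "S \<noteq> {}"
  shows "min N (int (card S) + int k) \<le> int (card ((\<lambda>(x, j). (x + j) mod N) ` (S \<times> {0..int k})))"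
    (is "_ \<le> int (card (?U k))")
proof (induction k)
  case 0
  have "?U 0 = S"
  proof -
    have "x mod N = x" if "x \<in> S" for x using that S by auto
    then show ?thesis by force
  qed
  then show ?case by simp
next
  case (Suc k)
  have fin: "finite S" using S(1) finite_subset by blast
  have finU: "finite (?U (Suc k))" by (simp add: fin)
  have sub: "?U k \<subseteq> ?U (Suc k)" by auto
  have succ: "(y + 1) mod N \<in> ?U (Suc k)" if y: "y \<in> ?U k" for y
  proof -
    obtain x j where xj: "x \<in> S" "0 \<le> j" "j \<le> int k" "y = (x + j) mod N"
      using y by auto
    then have "(y + 1) mod N = (x + (j + 1)) mod N"
      by (simp add: mod_simps add.assoc)
    then show ?thesis using xj by (intro image_eqI[of _ _ "(x, j + 1)"]) auto
  qed
  show ?case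
  proof (cases "?U (Suc k) = ?U k")
    case False
    then have "card (?U k) < card (?U (Suc k))"
      using sub finU by (intro psubset_card_mono) auto
    then show ?thesis using Suc.IH by linarith
  next
    case True
    obtain x where x: "x \<in> S" using S(2) by blast
    have step: "(x + int i) mod N \<in> ?U k" for i
    proof (induction i)
      case 0
      show ?case using x by (intro image_eqI[of _ _ "(x, 0)"]) auto
    next
      case (Suc i)
      have "((x + int i) mod N + 1) mod N \<in> ?U k"
        using succ[OF Suc.IH] True by simp
      then show ?case by (simp add: mod_simps add_ac)
    qed
    have "{0..<N} \<subseteq> ?U k"
    proof
      fix y assume y: "y \<in> {0..<N}"
      have "x < N" using x S by auto
      then have "(x + int (nat (y - x + N))) mod N = y" using y by simp
      then show "y \<in> ?U k" using step[of "nat (y - x + N)"] by simp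
    qed
    then have "card {0..<N} \<le> card (?U (Suc k))"
      using finU True by (intro card_mono) auto
    then show ?thesis using N by simp
  qed
qed

text \<open>The odd multiples of \<open>h\<close> are the lifts of the antipode of 0 in the cycle of
  length \<open>2 * h\<close>: \<open>z\<close> lies on the arc of radius \<open>r\<close> around
  that antipode.\<close>

definition arc_adj :: "int \<Rightarrow> int \<Rightarrow> int \<Rightarrow> bool" where
  "arc_adj h r z \<longleftrightarrow> (\<exists>k. \<bar>z - (2 * k + 1) * h\<bar> \<le> r)"

lemma arc_adj_uminus: "arc_adj h r (- z) \<longleftrightarrow> arc_adj h r z"
proof -
  have *: "arc_adj h r (- z)" if z: "arc_adj h r z" for z
  proof -
    obtain k where k: "\<bar>z - (2 * k + 1) * h\<bar> \<le> r" using z by (auto simp: arc_adj_def)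
    have "- z - (2 * (- k - 1) + 1) * h = - (z - (2 * k + 1) * h)" by (simp add: algebra_simps)
    then show ?thesis using k unfolding arc_adj_def by (metis abs_minus_cancel)
  qed
  from *[of z] *[of "- z"] show ?thesis by auto
qed

text \<open>Three odd multiples of \<open>h\<close> add up to an odd multiple, which has absolute
  value at least \<open>h\<close>; the errors are too small to cancel it. Applied to the differences
  around a triangle, this gives triangle-freeness.\<close>

lemma arc_adj_sum_neq_0:
  assumes "arc_adj h r1 z1" "arc_adj h r2 z2" "arc_adj h r3 z3" "r1 + r2 + r3 < h"
  shows "z1 + z2 + z3 \<noteq> 0"
proof
  assume 0: "z1 + z2 + z3 = 0"
  obtain k1 k2 k3 where k: "\<bar>z1 - (2 * k1 + 1) * h\<bar> \<le> r1"
      "\<bar>z2 - (2 * k2 + 1) * h\<bar> \<le> r2" "\<bar>z3 - (2 * k3 + 1) * h\<bar> \<le> r3"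
    using assms by (auto simp: arc_adj_def)
  define m where "m = 2 * (k1 + k2 + k3 + 1) + 1"
  have "m * h = (2 * k1 + 1) * h + (2 * k2 + 1) * h + (2 * k3 + 1) * h"
    by (simp add: m_def algebra_simps)
  then have "\<bar>m * h\<bar> < h" using k 0 assms(4) by linarith
  moreover have "\<bar>m\<bar> \<ge> 1" unfolding m_def by presburger
  then have "\<bar>h\<bar> \<le> \<bar>m * h\<bar>" by (simp add: abs_mult mult_le_cancel_right1)
  ultimately show False by linarith
qed

lemma card_arc_adj:
  assumes "0 \<le> r" "r < h"
  shows "int (card {y \<in> {0..<2 * h}. arc_adj h r (x - y)}) = 2 * r + 1"
proof -
  have "bij_betw (\<lambda>j. (x - h - j) mod (2 * h)) {- r..r} {y \<in> {0..<2 * h}. arc_adj h r (x - y)}"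
  proof (rule bij_betwI')
    fix i j assume ij: "i \<in> {- r..r}" "j \<in> {- r..r}"
    show "(x - h - i) mod (2 * h) = (x - h - j) mod (2 * h) \<longleftrightarrow> i = j"
    proof
      assume "(x - h - i) mod (2 * h) = (x - h - j) mod (2 * h)"
      then have "2 * h dvd (j - i)"
        by (simp add: mod_eq_dvd_iff algebra_simps)
      moreover have "\<bar>j - i\<bar> < \<bar>2 * h\<bar>" using ij assms by auto
      ultimately have "j - i = 0" by (metis dvd_imp_le_int not_less)
      then show "i = j" by simp
    qed simp
  next
    fix j assume j: "j \<in> {- r..r}"
    define m where "m = (x - h - j) div (2 * h)"
    have m: "(x - h - j) mod (2 * h) = x - h - j - m * (2 * h)"
      unfolding m_def by (simp add: minus_div_mult_eq_mod)
    have "\<bar>x - (x - h - j) mod (2 * h) - (2 * m + 1) * h\<bar> \<le> r"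
      unfolding m using j by (simp add: algebra_simps abs_le_iff)
    then show "(x - h - j) mod (2 * h) \<in> {y \<in> {0..<2 * h}. arc_adj h r (x - y)}"
      using assms by (auto simp: arc_adj_def)
  next
    fix y assume y: "y \<in> {y \<in> {0..<2 * h}. arc_adj h r (x - y)}"
    then obtain k where k: "\<bar>x - y - (2 * k + 1) * h\<bar> \<le> r" by (auto simp: arc_adj_def)
    define j where "j = x - y - (2 * k + 1) * h"
    have "x - h - j = y + k * (2 * h)" by (simp add: j_def algebra_simps)
    then have "(x - h - j) mod (2 * h) = y" using y by simp
    moreover have "j \<in> {- r..r}" using k by (auto simp: j_def)
    ultimately show "\<exists>j\<in>{- r..r}. y = (x - h - j) mod (2 * h)" by metis
  qed
  then have "card {y \<in> {0..<2 * h}. arc_adj h r (x - y)} = card {- r..r}"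
    by (metis bij_betw_same_card)
  then show ?thesis using assms by simp
qed

lemma card_arc_nbhd:
  assumes "0 \<le> r" "r < h" "S \<subseteq> {0..<2 * h}" "S \<noteq> {}"
  shows "min (2 * h) (int (card S) + 2 * r)
    \<le> int (card {y \<in> {0..<2 * h}. \<exists>x\<in>S. arc_adj h r (x - y)})"
proof -
  define sh where "sh x = (x - h - r) mod (2 * h)" for x
  have inj: "inj_on sh S"
  proof
    fix x y assume xy: "x \<in> S" "y \<in> S" "sh x = sh y"
    then have "2 * h dvd (x - y)" by (simp add: sh_def mod_eq_dvd_iff algebra_simps)
    moreover have "\<bar>x - y\<bar> < \<bar>2 * h\<bar>" using subsetD[OF assms(3) xy(1)] subsetD[OF assms(3) xy(2)] by auto
    ultimately have "x - y = 0" by (metis dvd_imp_le_int not_less)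
    then show "x = y" by simp
  qed
  have "min (2 * h) (int (card (sh ` S)) + int (nat (2 * r))) \<le>
    int (card ((\<lambda>(x, j). (x + j) mod (2 * h)) ` (sh ` S \<times> {0..int (nat (2 * r))})))"
    using assms by (intro card_cyclic_sumset_interval) (auto simp: sh_def)
  also have "\<dots> \<le> int (card {y \<in> {0..<2 * h}. \<exists>x\<in>S. arc_adj h r (x - y)})"
  proof -
    have "arc_adj h r (x - (sh x + j) mod (2 * h))" if j: "0 \<le> j" "j \<le> 2 * r" for x j
    proof -
      define m where "m = (x - h - r + j) div (2 * h)"
      have "(sh x + j) mod (2 * h) = (x - h - r + j) mod (2 * h)"
        by (simp add: sh_def mod_simps)
      also have "\<dots> = x - h - r + j - m * (2 * h)"
        unfolding m_def by (simp add: minus_div_mult_eq_mod)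
      finally have "x - (sh x + j) mod (2 * h) - (2 * m + 1) * h = r - j"
        by (simp add: algebra_simps)
      then show ?thesis using j unfolding arc_adj_def by (intro exI[of _ m]) auto
    qed
    then have "(\<lambda>(x, j). (x + j) mod (2 * h)) ` (sh ` S \<times> {0..int (nat (2 * r))})
      \<subseteq> {y \<in> {0..<2 * h}. \<exists>x\<in>S. arc_adj h r (x - y)}"
      using assms by fastforce
    moreover have "finite {y \<in> {0..<2 * h}. \<exists>x\<in>S. arc_adj h r (x - y)}"
      by (rule finite_subset[of _ "{0..<2 * h}"]) auto
    ultimately show ?thesis using card_mono by (simp only: of_nat_le_iff)
  qed
  finally show ?thesis using assms by (simp add: card_image[OF inj])
qed

lemma tight_ratio_bicirculant:
  fixes p q :: nat
  assumes pq: "q < 4 * p" "3 * p \<le> q"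
  shows "tight_ratio (real p / real q)"
proof -
  \<comment> \<open>Arcs of radius \<open>s\<close> within and \<open>t\<close> between the two cycles. Triangle-freeness needs
    \<open>s + 2 t < h\<close>, and the extremal choice \<open>h = s + 2 t + 1\<close> makes independence number and degree agree.\<close>
  define h s t where hst: "h = int q" "s = 4 * int p - int q - 1" "t = int q - 2 * int p"
  define \<rho> where "\<rho> i j = (if i = j then s else t)" for i j :: bool
  define V where "V = {0..<2 * h} \<times> (UNIV :: bool set)"
  define E where "E = (\<lambda>(x, i) (y, j). arc_adj h (\<rho> i j) (x - y))"
  \<comment> \<open>The hypothesis \<open>q < 4 * p\<close> gives \<open>0 \<le> s\<close>, and
    \<open>3 * p \<le> q\<close> gives \<open>s \<le> t\<close>. The radii along a triangle sum to
    \<open>3 * s\<close> or \<open>s + 2 * t\<close>, so the latter is the larger one.\<close>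
  have bnds: "0 \<le> s" "s \<le> t" "0 \<le> t" "t < h" "s < h" "h = s + 2 * t + 1"
    using pq by (auto simp: hst)
  have split: "A = (\<lambda>x. (x, False)) ` {x. (x, False) \<in> A} \<union> (\<lambda>x. (x, True)) ` {x. (x, True) \<in> A}"
    for A :: "(int \<times> bool) set"
  proof -
    have "z \<in> A \<longleftrightarrow>
      z \<in> (\<lambda>x. (x, False)) ` {x. (x, False) \<in> A} \<union> (\<lambda>x. (x, True)) ` {x. (x, True) \<in> A}" for z
      by (cases z; cases "snd z") auto
    then show ?thesis by (rule set_eqI)
  qed
  have card_split: "card A = card {x. (x, False) \<in> A} + card {x. (x, True) \<in> A}"
    if A: "A \<subseteq> V" for A
  proof -
    have "finite {x. (x, b) \<in> A}" for b
      by (rule finite_subset[of _ "{0..<2 * h}"]) (use A in \<open>auto simp: V_def\<close>)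
    then have "card ((\<lambda>x. (x, False)) ` {x. (x, False) \<in> A} \<union> (\<lambda>x. (x, True)) ` {x. (x, True) \<in> A})
      = card {x. (x, False) \<in> A} + card {x. (x, True) \<in> A}"
      by (subst card_Un_disjoint) (auto simp: card_image inj_on_def)
    then show ?thesis using split[of A] by simp
  qed
  have "tight_graph V E (\<lambda>_. 1) (4 * p)"
    unfolding tight_graph_def
  proof (intro conjI allI ballI impI)
    show "finite V" by (simp add: V_def)
    show "E y x" if "E x y" for x y
    proof -
      obtain a i b j where [simp]: "x = (a, i)" "y = (b, j)" by (meson surj_pair)
      have "arc_adj h (\<rho> i j) (- (a - b))"
        using that unfolding arc_adj_uminus by (simp add: E_def)
      moreover have "\<rho> i j = \<rho> j i" by (simp add: \<rho>_def)
      ultimately show ?thesis by (simp add: E_def)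
    qed
    show "\<not> (E x y \<and> E y z \<and> E x z)" for x y z
    proof
      obtain a i b j c k where [simp]: "x = (a, i)" "y = (b, j)" "z = (c, k)" by (meson surj_pair)
      assume "E x y \<and> E y z \<and> E x z"
      then have "arc_adj h (\<rho> i j) (a - b)" "arc_adj h (\<rho> j k) (b - c)" "arc_adj h (\<rho> i k) (- (a - c))"
        unfolding arc_adj_uminus by (simp_all add: E_def)
      moreover have "\<rho> i j + \<rho> j k + \<rho> i k < h" using bnds by (auto simp: \<rho>_def)
      ultimately have "(a - b) + (b - c) + - (a - c) \<noteq> 0" by (rule arc_adj_sum_neq_0)
      then show False by simp
    qed
    show "(\<Sum>_\<in>{y \<in> V. E x y}. 1) = 4 * p" if "x \<in> V" for x
    proof -
      obtain a i where [simp]: "x = (a, i)" by (meson surj_pair)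
      have *: "{y. (y, j) \<in> {y \<in> V. E x y}} = {y \<in> {0..<2 * h}. arc_adj h (\<rho> i j) (a - y)}" for j
        by (auto simp: V_def E_def)
      have deg: "int (card {y \<in> {0..<2 * h}. arc_adj h (\<rho> i j) (a - y)}) = 2 * \<rho> i j + 1" for j
        by (rule card_arc_adj) (use bnds in \<open>auto simp: \<rho>_def\<close>)
      have "int (card {y \<in> V. E x y}) = (2 * \<rho> i False + 1) + (2 * \<rho> i True + 1)"
        using deg[of False] deg[of True] by (subst card_split) (auto simp only: * of_nat_add)
      also have "\<dots> = int (4 * p)" by (cases i) (auto simp: \<rho>_def hst)
      finally show ?thesis by simp
    qed
    show "(\<Sum>_\<in>S. 1) \<le> 4 * p" if S: "S \<subseteq> V" "\<forall>x\<in>S. \<forall>y\<in>S. \<not> E x y" for S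
    proof -
      define T where "T j = {x. (x, j) \<in> S}" for j
      have T: "T j \<subseteq> {0..<2 * h}" for j using S by (auto simp: T_def V_def)
      have finT: "finite (T j)" for j using T finite_subset by blast
      \<comment> \<open>The part of \<open>S\<close> in cycle \<open>j\<close> avoids the
        neighbourhood of the part in cycle \<open>i\<close>. If \<open>T j\<close> is nonempty the
        minimum cannot be \<open>2 * h\<close>, so the two sizes sum to at most
        \<open>2 * h - 2 * \<rho> i j\<close>: taken with \<open>i = j\<close> for a set inside one
        cycle, and with radius \<open>t\<close> for a set meeting both.\<close>
      have nbr: "int (card (T j)) + min (2 * h) (int (card (T i)) + 2 * \<rho> i j) \<le> 2 * h"
        if "T i \<noteq> {}" for i j
      proof -
        let ?M = "{y \<in> {0..<2 * h}. \<exists>x\<in>T i. arc_adj h (\<rho> i j) (x - y)}"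
        have "T j \<inter> ?M = {}" using S(2) by (auto simp: T_def E_def)
        then have "card (T j) + card ?M = card (T j \<union> ?M)"
          by (intro card_Un_disjoint[symmetric] finT finite_subset[of ?M "{0..<2 * h}"]) auto
        also have "\<dots> \<le> card {0..<2 * h}"
          using T by (intro card_mono) auto
        finally have "int (card (T j)) + int (card ?M) \<le> 2 * h" using bnds by simp
        moreover have "min (2 * h) (int (card (T i)) + 2 * \<rho> i j) \<le> int (card ?M)"
          using bnds that T by (intro card_arc_nbhd) (auto simp: \<rho>_def)
        ultimately show ?thesis by linarith
      qed
      have "int (card (T False)) + int (card (T True)) \<le> 4 * int p"
      proof (cases "T False = {} \<or> T True = {}")
        case True
        have "int (card (T j)) \<le> 4 * int p" for j
        proof (cases "T j = {}")
          case False
          then have "card (T j) > 0" using finT by (simp add: card_gt_0_iff)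
          then have "2 * int (card (T j)) + 2 * s \<le> 2 * h"
            using nbr[OF False, of j] by (simp add: \<rho>_def)
          then have "int (card (T j)) \<le> 2 * t + 1" using bnds(6) by linarith
          moreover have "2 * t + 1 \<le> 4 * int p" using bnds(1) by (simp add: hst)
          ultimately show ?thesis by linarith
        qed simp
        with True show ?thesis by auto
      next
        case False
        then have "card (T True) > 0" using finT by (simp add: card_gt_0_iff)
        then have "int (card (T False)) + int (card (T True)) + 2 * t \<le> 2 * h"
          using nbr[of False True] False by (simp add: \<rho>_def)
        then show ?thesis using bnds by (auto simp: hst)
      qed
      then show ?thesis using card_split[OF S(1)] by (simp add: T_def)
    qed
  qed
  moreover have "sum (\<lambda>_. 1) V = 4 * q"
    by (simp add: V_def hst card_cartesian_product)
  ultimately have "tight_ratio (real (4 * p) / real (4 * q))"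
    using tight_ratioI[of V E "\<lambda>_. 1" "4 * p"] pq by simp
  then show ?thesis by simp
qed

subsection \<open>The weighted Mycielskian\<close>

text \<open>A bound valid at each vertex \<open>x\<close> is averaged with weights
  \<open>w x\<close>; by double counting and regularity, each set \<open>A\<close> then contributes
  \<open>d * sum w A\<close>. In the Mycielskian the result, read as
  \<open>(N - d) w(S) \<le> d w(M)\<close>, trades original vertices for the shadows they
  exclude.\<close>

lemma tight_graph_nbhd_weight:
  assumes G: "tight_graph V E w d"
    and S: "S \<subseteq> V" "\<And>x y. x \<in> S \<Longrightarrow> y \<in> S \<Longrightarrow> \<not> E x y"
  shows "sum w V * sum w S \<le> d * (sum w {y \<in> V. \<exists>x\<in>S. E x y} + sum w S)"
proof -
  define M where "M = {y \<in> V. \<exists>x\<in>S. E x y}"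
  note finV = tight_graphD(1)[OF G] and sym = tight_graphD(2)[OF G]
    and tri = tight_graphD(3)[OF G] and deg = tight_graphD(4)[OF G] and ind = tight_graphD(5)[OF G]
  have fin: "finite A" if "A \<subseteq> V" for A using that finV finite_subset by blast
  have MV: "M \<subseteq> V" by (auto simp: M_def)
  define n where "n x A = sum w {y \<in> A. E x y}" for x A
  \<comment> \<open>Replacing in \<open>N(x)\<close> the part adjacent to \<open>S\<close> by \<open>S\<close> keeps the set independent.\<close>
  have pt: "sum w S \<le> n x M + n x S" if x: "x \<in> V" for x
  proof -
    define T where "T = {y \<in> V. E x y} - M"
    have "\<not> E a b" if a: "a \<in> S \<union> T" and b: "b \<in> S \<union> T" for a b
    proof
      assume ab: "E a b"
      have aV: "a \<in> V" and bV: "b \<in> V" using a b S(1) by (auto simp: T_def)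
      consider "a \<in> S" "b \<in> S" | "a \<in> S" "b \<in> T" | "a \<in> T" "b \<in> S" | "a \<in> T" "b \<in> T"
        using a b by blast
      then show False
      proof cases
        case 1 then show ?thesis using S(2) ab by blast
      next
        case 2 then show ?thesis using ab bV by (auto simp: T_def M_def)
      next
        case 3 then show ?thesis using sym[OF ab] aV by (auto simp: T_def M_def)
      next
        case 4 then show ?thesis using tri[OF x aV bV _ ab] by (auto simp: T_def)
      qed
    qed
    then have "sum w (S \<union> T) \<le> d" by (intro ind) (use S(1) in \<open>auto simp: T_def\<close>)
    moreover have "sum w (S \<union> T) + sum w (S \<inter> T) = sum w S + sum w T"
      using S(1) by (intro sum.union_inter fin) (auto simp: T_def)
    moreover have "sum w (S \<inter> T) \<le> n x S"
      unfolding n_def using S(1) fin[OF S(1)] by (intro sum_mono2) (auto simp: T_def)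
    moreover have "d = sum w T + n x M"
    proof -
      have "{y \<in> V. E x y} = T \<union> {y \<in> M. E x y}" using MV by (auto simp: T_def)
      moreover have "sum w (T \<union> {y \<in> M. E x y}) = sum w T + n x M"
        unfolding n_def using MV by (intro sum.union_disjoint fin) (auto simp: T_def)
      ultimately show ?thesis using deg[OF x] by simp
    qed
    ultimately show ?thesis by linarith
  qed
  have dbl: "(\<Sum>x\<in>V. w x * n x A) = d * sum w A" if A: "A \<subseteq> V" for A
  proof -
    have "(\<Sum>x\<in>V. w x * n x A) = (\<Sum>x\<in>V. \<Sum>y\<in>A. if E x y then w x * w y else 0)"
      unfolding n_def sum_distrib_left
      by (rule sum.cong[OF refl], rule sum.inter_filter[OF fin[OF A]])
    also have "\<dots> = (\<Sum>y\<in>A. \<Sum>x\<in>V. if E x y then w x * w y else 0)"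
      by (rule sum.swap)
    also have "\<dots> = (\<Sum>y\<in>A. \<Sum>x | x \<in> V \<and> E y x. w x * w y)"
    proof (rule sum.cong[OF refl])
      fix y
      have "(\<Sum>x\<in>V. if E x y then w x * w y else 0) = (\<Sum>x\<in>V. if E y x then w x * w y else 0)"
        by (rule sum.cong[OF refl]) (metis sym)
      then show "(\<Sum>x\<in>V. if E x y then w x * w y else 0) = (\<Sum>x | x \<in> V \<and> E y x. w x * w y)"
        using sum.inter_filter[OF finV, of "\<lambda>x. w x * w y" "\<lambda>x. E y x"] by simp
    qed
    also have "\<dots> = (\<Sum>y\<in>A. d * w y)"
      using A by (intro sum.cong[OF refl]) (simp add: sum_distrib_right[symmetric] deg subset_iff)
    finally show ?thesis by (simp add: sum_distrib_left)
  qed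
  have "sum w V * sum w S = (\<Sum>x\<in>V. w x * sum w S)" by (simp add: sum_distrib_right)
  also have "\<dots> \<le> (\<Sum>x\<in>V. w x * (n x M + n x S))"
    by (intro sum_mono mult_left_mono pt) auto
  also have "\<dots> = d * sum w M + d * sum w S"
    by (simp add: algebra_simps sum.distrib dbl[OF MV] dbl[OF S(1)])
  finally show ?thesis by (simp add: M_def algebra_simps)
qed

text \<open>\<open>Some (x, False)\<close> is the original vertex, \<open>Some (x, True)\<close> its
  shadow and \<open>None\<close> the apex.\<close>

fun myc_adj :: "('a \<Rightarrow> 'a \<Rightarrow> bool) \<Rightarrow> ('a \<times> bool) option \<Rightarrow> ('a \<times> bool) option \<Rightarrow> bool" where
  "myc_adj E (Some (x, i)) (Some (y, j)) \<longleftrightarrow> E x y \<and> \<not> (i \<and> j)"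
| "myc_adj E None (Some (y, j)) \<longleftrightarrow> j"
| "myc_adj E (Some (x, i)) None \<longleftrightarrow> i"
| "myc_adj E None None \<longleftrightarrow> False"

text \<open>With \<open>c = d / N\<close>, originals, shadows and apex are weighted in proportion \<open>1 - c : c : c\<^sup>2\<close>,
  the only choice that makes the graph regular.\<close>

fun myc_weight :: "nat \<Rightarrow> nat \<Rightarrow> ('a \<Rightarrow> nat) \<Rightarrow> ('a \<times> bool) option \<Rightarrow> nat" where
  "myc_weight N d w (Some (x, i)) = (if i then d else N - d) * w x"
| "myc_weight N d w None = d\<^sup>2"

lemma sum_option_pair_bool:
  fixes f :: "('a \<times> bool) option \<Rightarrow> nat"
  assumes "finite A"
  shows "sum f A = (\<Sum>x | Some (x, False) \<in> A. f (Some (x, False)))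
    + (\<Sum>x | Some (x, True) \<in> A. f (Some (x, True))) + (if None \<in> A then f None else 0)"
proof -
  define B where "B i = {x. Some (x, i) \<in> A}" for i
  have fin: "finite (B i)" for i
    using finite_vimageI[OF assms, of "\<lambda>x. Some (x, i)"] by (simp add: B_def vimage_def inj_on_def)
  have "z \<in> A \<longleftrightarrow> z \<in> (\<lambda>x. Some (x, False)) ` B False \<union> (\<lambda>x. Some (x, True)) ` B True
      \<union> (if None \<in> A then {None} else {})" for z
  proof (cases z)
    case (Some a)
    then show ?thesis by (cases a; cases "snd a") (auto simp: B_def)
  qed auto
  then have A: "A = (\<lambda>x. Some (x, False)) ` B False \<union> (\<lambda>x. Some (x, True)) ` B True
      \<union> (if None \<in> A then {None} else {})"
    by (rule set_eqI)
  have inj: "inj_on (\<lambda>x. Some (x, i)) (B i)" for i by (simp add: inj_on_def)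
  have "sum f ((\<lambda>x. Some (x, False)) ` B False \<union> (\<lambda>x. Some (x, True)) ` B True
      \<union> (if None \<in> A then {None} else {}))
    = sum f ((\<lambda>x. Some (x, False)) ` B False) + sum f ((\<lambda>x. Some (x, True)) ` B True)
      + (if None \<in> A then f None else 0)"
    by (subst sum.union_disjoint, (use fin in auto)[3], subst sum.union_disjoint) (use fin in auto)
  then have "sum f A = sum f ((\<lambda>x. Some (x, False)) ` B False)
      + sum f ((\<lambda>x. Some (x, True)) ` B True) + (if None \<in> A then f None else 0)"
    by (simp only: A[symmetric])
  moreover have "sum f ((\<lambda>x. Some (x, i)) ` B i) = (\<Sum>x\<in>B i. f (Some (x, i)))" for i
    by (simp add: sum.reindex[OF inj])
  ultimately show ?thesis by (simp only: B_def)
qed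

text \<open>An independent set with the apex has no shadows and weighs at most
  \<open>(N - d) * d + d * d\<close>. Without the apex, its shadows \<open>B\<close> avoid the
  neighbourhood \<open>M\<close> of its originals \<open>A\<close>, so
  \<open>(N - d) w(A) + d w(B) \<le> d (w(M) + w(B)) \<le> d N\<close>. Both bounds equal the common
  degree \<open>N * d\<close>, and the total weight is \<open>N\<^sup>2 + d\<^sup>2\<close>.\<close>

lemma tight_ratio_Mycielskian:
  assumes "tight_ratio c"
  shows "tight_ratio (c / (1 + c\<^sup>2))"
proof -
  obtain V :: "nat set" and E w d where G: "tight_graph V E w d"
    and pos: "sum w V > 0" and c: "c = real d / real (sum w V)"
    using assms unfolding tight_ratio_def by blast
  note finV = tight_graphD(1)[OF G] and sym = tight_graphD(2)[OF G]
    and tri = tight_graphD(3)[OF G] and deg = tight_graphD(4)[OF G] and ind = tight_graphD(5)[OF G]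
  define N where "N = sum w V"
  have "V \<noteq> {}" using pos by auto
  then obtain v where "v \<in> V" by blast
  then have dN: "d \<le> N"
    using deg[of v] sum_mono2[OF finV, of "{y \<in> V. E v y}" w] by (simp add: N_def)
  define U where "U = insert None (Some ` (V \<times> (UNIV :: bool set)))"
  define w' where "w' = myc_weight N d w"
  have finU: "finite U" by (simp add: U_def finV)
  have U: "Some (x, i) \<in> U \<longleftrightarrow> x \<in> V" "None \<in> U" for x i by (auto simp: U_def)
  have sumU: "sum w' A = (N - d) * sum w {x. Some (x, False) \<in> A} + d * sum w {x. Some (x, True) \<in> A}
      + (if None \<in> A then d\<^sup>2 else 0)" if "A \<subseteq> U" for A
  proof -
    have "finite A" using that finU finite_subset by blast
    from sum_option_pair_bool[OF this, of w'] show ?thesis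
      by (simp add: w'_def sum_distrib_left)
  qed
  have "tight_graph U (myc_adj E) w' (N * d)"
    unfolding tight_graph_def
  proof (intro conjI allI ballI impI)
    show "finite U" by (rule finU)
    show "myc_adj E y x" if "myc_adj E x y" for x y
      using that by (cases "(E, x, y)" rule: myc_adj.cases) (auto intro: sym)
    show "\<not> (myc_adj E x y \<and> myc_adj E y z \<and> myc_adj E x z)"
      if "x \<in> U" "y \<in> U" "z \<in> U" for x y z
    proof
      assume a: "myc_adj E x y \<and> myc_adj E y z \<and> myc_adj E x z"
      have none: "x \<noteq> None" "y \<noteq> None" "z \<noteq> None"
        using a by (cases x; cases y; cases z; auto)+
      then obtain a i b j c k where "x = Some (a, i)" "y = Some (b, j)" "z = Some (c, k)"
        by (metis option.exhaust surj_pair)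
      with a that tri[of a b c] show False by (auto simp: U)
    qed
    show "sum w' {y \<in> U. myc_adj E x y} = N * d" if x: "x \<in> U" for x
    proof -
      have *: "sum w' {y \<in> U. myc_adj E x y} = (N - d) * sum w {y \<in> V. myc_adj E x (Some (y, False))}
        + d * sum w {y \<in> V. myc_adj E x (Some (y, True))} + (if myc_adj E x None then d\<^sup>2 else 0)"
        by (subst sumU) (auto simp: U)
      show ?thesis
      proof (cases x)
        case None
        then show ?thesis unfolding * by (simp add: N_def)
      next
        case (Some z)
        obtain a i where z: "z = (a, i)" by (cases z)
        then have "a \<in> V" using x Some by (simp add: U)
        have "(N - d) * d + d * d = N * d" using dN by (metis add_mult_distrib le_add_diff_inverse2)
        then show ?thesis unfolding * using Some z deg[OF \<open>a \<in> V\<close>]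
          by (cases i) (simp_all add: power2_eq_square)
      qed
    qed
    show "sum w' S \<le> N * d" if S: "S \<subseteq> U" "\<forall>x\<in>S. \<forall>y\<in>S. \<not> myc_adj E x y" for S
    proof -
      define A B where "A = {x. Some (x, False) \<in> S}" and "B = {x. Some (x, True) \<in> S}"
      have AV: "A \<subseteq> V" and BV: "B \<subseteq> V" using S(1) by (auto simp: A_def B_def U_def)
      have indA: "\<not> E x y" if "x \<in> A" "y \<in> A" for x y
        using S(2) that by (force simp: A_def)
      have AB: "\<not> E x y" if "x \<in> A" "y \<in> B" for x y
        using S(2) that by (force simp: A_def B_def)
      have Nd: "(N - d) * d + d * d = N * d" using dN by (metis add_mult_distrib le_add_diff_inverse2)
      show ?thesis
      proof (cases "None \<in> S")
        case True
        then have "B = {}" using S(2) by (force simp: B_def)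
        moreover have "(N - d) * sum w A \<le> (N - d) * d" using ind[OF AV indA] by (rule mult_le_mono2)
        moreover have "sum w' S = (N - d) * sum w A + d * sum w B + d * d"
          using sumU[OF S(1)] True by (simp add: A_def B_def power2_eq_square)
        ultimately show ?thesis using Nd \<open>B = {}\<close> by (metis add_le_mono1 add_0_right mult_0_right sum.empty)
      next
        case False
        let ?M = "{y \<in> V. \<exists>x\<in>A. E x y}"
        have "N * sum w A \<le> d * sum w ?M + d * sum w A"
          using tight_graph_nbhd_weight[OF G AV indA] by (simp add: N_def distrib_left)
        then have "(N - d) * sum w A \<le> d * sum w ?M"
          by (simp add: diff_mult_distrib)
        moreover have "sum w ?M + sum w B \<le> N"
        proof -
          have "sum w ?M + sum w B = sum w (?M \<union> B)"
            using AB finV BV finite_subset[OF BV finV] by (intro sum.union_disjoint[symmetric]) auto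
          also have "\<dots> \<le> N" unfolding N_def using BV finV by (intro sum_mono2) auto
          finally show ?thesis .
        qed
        then have "d * sum w ?M + d * sum w B \<le> N * d"
          by (metis distrib_left mult.commute mult_le_mono2)
        ultimately show ?thesis
          using sumU[OF S(1)] False by (simp add: A_def B_def)
      qed
    qed
  qed
  moreover have tot: "sum w' U = N\<^sup>2 + d\<^sup>2"
  proof -
    have "sum w' U = (N - d) * N + d * N + d\<^sup>2"
      using sumU[of U] by (simp add: U N_def)
    also have "(N - d) * N + d * N = N\<^sup>2"
      using dN by (metis add_mult_distrib le_add_diff_inverse2 power2_eq_square)
    finally show ?thesis .
  qed
  ultimately have "tight_ratio (real (N * d) / real (N\<^sup>2 + d\<^sup>2))"
    using tight_ratioI[of U "myc_adj E" w' "N * d"] pos by (simp add: N_def)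
  moreover have "real (N * d) / real (N\<^sup>2 + d\<^sup>2) = c / (1 + c\<^sup>2)"
    using pos unfolding c N_def[symmetric] by (simp add: field_simps power2_eq_square)
  ultimately show ?thesis by simp
qed

subsection \<open>Density of the attainable ratios\<close>

lemma tight_ratio_between_quarter_third:
  assumes "1 / 4 \<le> a" "a < b" "b \<le> 1 / 3"
  shows "\<exists>x. tight_ratio x \<and> a < x \<and> x < b"
proof -
  obtain r where r: "r \<in> \<rat>" "a < r" "r < b" using Rats_dense_in_real[OF assms(2)] by blast
  then obtain p q :: nat where pq: "q \<noteq> 0" "\<bar>r\<bar> = real p / real q"
    using Rats_abs_nat_div_natE by metis
  have r': "r = real p / real q" using pq r assms by auto
  have "1 / 4 < real p / real q" "real p / real q \<le> 1 / 3"
    using r assms r' by linarith+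
  then have "real q < 4 * real p" "3 * real p \<le> real q"
    using pq(1) by (auto simp: field_simps)
  then have "tight_ratio r"
    unfolding r' by (intro tight_ratio_bicirculant) linarith+
  then show ?thesis using r by blast
qed

text \<open>At 1/3 the map takes the value 3/10, above 1/4, so the intermediate value theorem yields
  a preimage. The identity \<open>x = y + y * x\<^sup>2\<close> with \<open>y \<le> x\<close> gives
  the last bound, a guaranteed climb when going backwards.\<close>

lemma Mycielski_preimage:
  fixes y :: real
  assumes "0 < y" "y \<le> 1 / 4"
  obtains x where "0 < x" "x < 1 / 3" "y = x / (1 + x\<^sup>2)" "y + y ^ 3 \<le> x"
proof -
  have "\<exists>x\<ge>0. x \<le> 1 / 3 \<and> x / (1 + x\<^sup>2) = y"
    using assms by (intro IVT'[of "\<lambda>x. x / (1 + x\<^sup>2)"] continuous_intros)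
      (auto simp: power2_eq_square add_nonneg_eq_0_iff)
  then obtain x where x: "0 \<le> x" "x \<le> 1 / 3" "x / (1 + x\<^sup>2) = y" by blast
  have pos: "1 + x\<^sup>2 > 0" by (simp add: add_pos_nonneg)
  have xy: "x = y + y * x\<^sup>2" using x(3) pos by (simp add: field_simps)
  have "x \<noteq> 1 / 3"
  proof
    assume "x = 1 / 3"
    then have "y = 3 / 10" unfolding x(3)[symmetric] by (simp only: power2_eq_square) simp
    then show False using assms by simp
  qed
  moreover have "0 \<le> y * x\<^sup>2" using assms by simp
  then have "y \<le> x" using xy by linarith
  moreover from this have "y\<^sup>2 \<le> x\<^sup>2" using assms by (intro power_mono) auto
  then have "y * y\<^sup>2 \<le> y * x\<^sup>2" using assms by (intro mult_left_mono) auto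
  then have "y + y ^ 3 \<le> x" using xy by (simp add: power3_eq_cube power2_eq_square)
  ultimately show ?thesis using that[of x] x assms by auto
qed

lemma Mycielski_map_strict_mono_iff:
  fixes x y :: real
  assumes "0 < x" "x < 1" "0 < y" "y < 1"
  shows "x / (1 + x\<^sup>2) < y / (1 + y\<^sup>2) \<longleftrightarrow> x < y"
proof -
  have pos: "1 + x\<^sup>2 > 0" "1 + y\<^sup>2 > 0" by (simp_all add: add_pos_nonneg)
  have "x / (1 + x\<^sup>2) < y / (1 + y\<^sup>2) \<longleftrightarrow> 0 < (y - x) * (1 - x * y)"
    using pos by (simp add: divide_less_eq less_divide_eq field_simps power2_eq_square)
  moreover have "x * y < 1" using mult_strict_mono[of x 1 y 1] assms by simp
  ultimately show ?thesis by (simp add: zero_less_mult_iff)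
qed

lemma tight_ratio_dense:
  assumes "0 < a" "a < b" "b \<le> 1 / 3"
  shows "\<exists>x. tight_ratio x \<and> a < x \<and> x < b"
proof -
  \<comment> \<open>Here \<open>k\<close> bounds the number of pullbacks still needed. Passing to
    the preimage raises the left endpoint by at least \<open>a' ^ 3 \<ge> a ^ 3\<close>, which pays
    for lowering \<open>k\<close> by one; at \<open>k = 0\<close> the interval starts at 1/4 or
    later.\<close>
  have *: "\<exists>x. tight_ratio x \<and> a' < x \<and> x < b'"
    if "a \<le> a'" "a' < b'" "b' \<le> 1 / 3" "1 / 4 \<le> a' + real k * a ^ 3" for k a' b'
    using that
  proof (induction k arbitrary: a' b')
    case 0
    then show ?case using tight_ratio_between_quarter_third by simp
  next
    case (Suc k)
    show ?case
    proof (cases "1 / 4 \<le> a'")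
      case True
      then show ?thesis using tight_ratio_between_quarter_third Suc.prems by blast
    next
      case False
      \<comment> \<open>Cutting at 1/4 guarantees that the right endpoint, too, has a preimage below
        1/3.\<close>
      define b'' where "b'' = min b' (1 / 4)"
      have b'': "a' < b''" "b'' \<le> 1 / 4" "b'' \<le> b'"
        using False Suc.prems by (auto simp: b''_def)
      obtain y where y: "0 < y" "y < 1 / 3" "a' = y / (1 + y\<^sup>2)" "a' + a' ^ 3 \<le> y"
        using Mycielski_preimage[of a'] Suc.prems assms False by auto
      obtain z where z: "0 < z" "z < 1 / 3" "b'' = z / (1 + z\<^sup>2)"
        using Mycielski_preimage[of b''] Suc.prems assms b'' by auto
      have "y < z" using b''(1) y z Mycielski_map_strict_mono_iff[of y z] by simp
      moreover have "a ^ 3 \<le> a' ^ 3" using Suc.prems assms by (intro power_mono) auto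
      moreover have "0 \<le> a ^ 3" using assms by simp
      ultimately have "\<exists>x. tight_ratio x \<and> y < x \<and> x < z"
      proof (intro Suc.IH)
        have "0 \<le> a' ^ 3" using \<open>a ^ 3 \<le> a' ^ 3\<close> \<open>0 \<le> a ^ 3\<close> by linarith
        then show "a \<le> y" using y(4) Suc.prems(1) by linarith
        have "a' + real (Suc k) * a ^ 3 = a' + a ^ 3 + real k * a ^ 3" by (simp add: algebra_simps)
        then show "1 / 4 \<le> y + real k * a ^ 3"
          using y(4) Suc.prems(4) \<open>a ^ 3 \<le> a' ^ 3\<close> by linarith
      qed (use z in auto)
      then obtain x where x: "tight_ratio x" "y < x" "x < z" by blast
      have "a' < x / (1 + x\<^sup>2)" "x / (1 + x\<^sup>2) < b''"
        using x y z Mycielski_map_strict_mono_iff[of y x] Mycielski_map_strict_mono_iff[of x z]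
        by auto
      then show ?thesis using tight_ratio_Mycielskian[OF x(1)] b'' by force
    qed
  qed
  obtain k where "1 / 4 < real k * a ^ 3"
    using reals_Archimedean3[of "a ^ 3"] assms by (meson zero_less_power)
  then show ?thesis using *[of a b k] assms by simp
qed

subsection \<open>Sparse relations without large empty rectangles\<close>

lemma card_prod_by_fst:
  assumes "finite A"
  shows "card {(x, y) \<in> A \<times> A. r x y} = (\<Sum>x\<in>A. card {y \<in> A. r x y})"
proof -
  have "{(x, y) \<in> A \<times> A. r x y} = Sigma A (\<lambda>x. {y \<in> A. r x y})" by auto
  then show ?thesis using assms by simp
qed

lemma sum_card_swap:
  assumes "finite A" "finite B"
  shows "(\<Sum>y\<in>B. card {x \<in> A. r x y}) = (\<Sum>x\<in>A. card {y \<in> B. r x y})"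
  using sum.swap_restrict[OF assms, of "\<lambda>_ _. 1::nat" r] by simp

text \<open>A deterministic substitute for a sparse random graph. Incidence reads
  \<open>b + b' = a * a'\<close> modulo \<open>q\<close>, which is symmetric, so points and lines
  can share one vertex set.\<close>

lemma sparse_symmetric_relation:
  fixes e :: real
  assumes "0 < e"
  obtains K :: "(int \<times> int) set" and F where "finite K" "K \<noteq> {}" "\<And>x y. F x y \<longleftrightarrow> F y x"
    "real (card {(x, y) \<in> K \<times> K. F x y}) \<le> e * (real (card K))\<^sup>2"
    "\<And>X Y. X \<subseteq> K \<Longrightarrow> Y \<subseteq> K \<Longrightarrow> e * real (card K) \<le> real (card X) \<Longrightarrow>
      e * real (card K) \<le> real (card Y) \<Longrightarrow> \<exists>x\<in>X. \<exists>y\<in>Y. F x y"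
proof -
  \<comment> \<open>Both summands are used: \<open>q > 1 / e\<close> makes the density
    \<open>1 / q\<close> at most \<open>e\<close>, and \<open>q > 1 / e\<^sup>2\<close> drives the
    contradiction for two large sets with no related pair.\<close>
  obtain m :: nat where m: "1 / e + 1 / e\<^sup>2 < real m" using reals_Archimedean2 by blast
  obtain q' :: nat where q': "prime q'" "m < q'" using bigger_prime by blast
  define q where "q = int q'"
  have q: "prime q" using q'(1) by (simp add: q_def)
  have q0: "0 < q" using q by (simp add: prime_gt_0_int)
  have mq: "1 / e + 1 / e\<^sup>2 < real_of_int q" using m q'(2) by (simp add: q_def)
  have "0 < 1 / e" "0 < 1 / e\<^sup>2" using assms by auto
  with mq have "1 / e < real_of_int q" "1 / e\<^sup>2 < real_of_int q" by linarith+
  then have eq: "1 < e * real_of_int q" "1 < e\<^sup>2 * real_of_int q"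
    using assms by (auto simp: field_simps)
  define K where "K = {0..<q} \<times> {0..<q}"
  \<comment> \<open>Incidence of the point \<open>(a, b)\<close> with the line \<open>Y = a' X - b'\<close> over the field with \<open>q\<close> elements.\<close>
  define F where "F x y \<longleftrightarrow> q dvd (snd x + snd y - fst x * fst y)" for x y :: "int \<times> int"
  have fin: "finite K" by (simp add: K_def)
  have cardK: "real (card K) = (real_of_int q)\<^sup>2"
    using q0 by (simp add: K_def card_cartesian_product power2_eq_square)
  have sym: "F x y \<longleftrightarrow> F y x" for x y by (simp add: F_def algebra_simps)
  have deg: "real (card {y \<in> K. F x y}) = real_of_int q" for x
  proof -
    have "{y \<in> K. F x y} = (\<lambda>a. (a, (fst x * a - snd x) mod q)) ` {0..<q}"
    proof (rule set_eqI, rule iffI)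
      fix y assume y: "y \<in> {y \<in> K. F x y}"
      then have "q dvd (snd y - (fst x * fst y - snd x))" by (simp add: F_def algebra_simps)
      then have "snd y mod q = (fst x * fst y - snd x) mod q" by (simp add: mod_eq_dvd_iff)
      moreover have "snd y mod q = snd y" using y by (auto simp: K_def)
      ultimately show "y \<in> (\<lambda>a. (a, (fst x * a - snd x) mod q)) ` {0..<q}"
        using y by (intro image_eqI[of _ _ "fst y"]) (auto simp: K_def prod_eq_iff)
    next
      fix y assume "y \<in> (\<lambda>a. (a, (fst x * a - snd x) mod q)) ` {0..<q}"
      then obtain a where a: "a \<in> {0..<q}" "y = (a, (fst x * a - snd x) mod q)" by blast
      have "q dvd ((fst x * a - snd x) mod q - (fst x * a - snd x))"
        by (simp flip: mod_eq_dvd_iff)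
      then show "y \<in> {y \<in> K. F x y}" using a q0 by (simp add: K_def F_def algebra_simps)
    qed
    moreover have "inj_on (\<lambda>a. (a, (fst x * a - snd x) mod q)) {0..<q}" by (simp add: inj_on_def)
    ultimately show ?thesis using q0 by (simp add: card_image)
  qed
  have eqI: "a = b" if "q dvd a - b" "a \<in> {0..<q}" "b \<in> {0..<q}" for a b
  proof -
    have "a mod q = b mod q" using that(1) by (simp add: mod_eq_dvd_iff)
    then show ?thesis using that(2,3) by simp
  qed
  \<comment> \<open>Subtracting the two incidences eliminates \<open>snd u\<close> and leaves a
    linear equation for \<open>fst u\<close> modulo the prime \<open>q\<close>. Its coefficient is
    nonzero, since otherwise \<open>x\<close> and \<open>x'\<close> would agree; hence
    \<open>fst u\<close>, and then \<open>snd u\<close>, is determined.\<close>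
  have codeg: "card {y \<in> K. F x y \<and> F x' y} \<le> 1" if x: "x \<in> K" "x' \<in> K" "x \<noteq> x'" for x x'
  proof -
    have "y = z" if y: "y \<in> K" "F x y" "F x' y" and z: "z \<in> K" "F x z" "F x' z" for y z
    proof -
      have d: "q dvd (snd x - snd x') - (fst x - fst x') * fst u" if "F x u" "F x' u" for u
      proof -
        have "(snd x - snd x') - (fst x - fst x') * fst u
          = (snd x + snd u - fst x * fst u) - (snd x' + snd u - fst x' * fst u)"
          by (simp add: algebra_simps)
        then show ?thesis using that unfolding F_def by (metis dvd_diff)
      qed
      have ne: "\<not> q dvd fst x - fst x'"
      proof
        assume *: "q dvd fst x - fst x'"
        then have "q dvd (fst x - fst x') * fst y" by simp
        with d[OF y(2,3)] have "q dvd snd x - snd x'" by (metis diff_add_cancel dvd_add)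
        with * x show False using eqI[of "fst x" "fst x'"] eqI[of "snd x" "snd x'"]
          by (auto simp: K_def)
      qed
      have "(fst x - fst x') * (fst y - fst z) = ((snd x - snd x') - (fst x - fst x') * fst z)
          - ((snd x - snd x') - (fst x - fst x') * fst y)"
        by (simp add: algebra_simps)
      then have "q dvd (fst x - fst x') * (fst y - fst z)"
        using d[OF y(2,3)] d[OF z(2,3)] by (metis dvd_diff)
      then have "q dvd fst y - fst z" using ne q by (simp add: prime_dvd_mult_iff)
      then have f: "fst y = fst z" using y(1) z(1) by (intro eqI) (auto simp: K_def)
      have "snd y - snd z = (snd x + snd y - fst x * fst y) - (snd x + snd z - fst x * fst z)"
        by (simp add: f)
      then have "q dvd snd y - snd z" using y(2) z(2) unfolding F_def by (metis dvd_diff)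
      then have "snd y = snd z" using y(1) z(1) by (intro eqI) (auto simp: K_def)
      with f show ?thesis by (simp add: prod_eq_iff)
    qed
    then show ?thesis using fin by (auto simp: card_le_Suc0_iff_eq)
  qed
  show ?thesis
  proof (rule that)
    show "finite K" by (rule fin)
    show "K \<noteq> {}" using q0 by (simp add: K_def)
    show "F x y \<longleftrightarrow> F y x" for x y by (rule sym)
    have "real (card {(x, y) \<in> K \<times> K. F x y}) = real (card K) * real_of_int q"
      by (simp only: card_prod_by_fst[OF fin] of_nat_sum deg sum_constant)
    also have "\<dots> \<le> real (card K) * (e * real_of_int q * real_of_int q)"
      using eq(1) q0 by (intro mult_left_mono) auto
    also have "\<dots> = e * (real (card K))\<^sup>2" by (simp add: cardK power2_eq_square)
    finally show "real (card {(x, y) \<in> K \<times> K. F x y}) \<le> e * (real (card K))\<^sup>2" .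
    \<comment> \<open>Second moment: \<open>y\<close> has about \<open>|X| / q\<close> neighbours in \<open>X\<close>, so few \<open>y\<close> have none.\<close>
    show "\<exists>x\<in>X. \<exists>y\<in>Y. F x y"
      if X: "X \<subseteq> K" "e * real (card K) \<le> real (card X)"
        and Y: "Y \<subseteq> K" "e * real (card K) \<le> real (card Y)" for X Y
    proof (rule ccontr)
      assume no: "\<not> (\<exists>x\<in>X. \<exists>y\<in>Y. F x y)"
      have finX: "finite X" and finY: "finite Y" using X Y fin finite_subset by blast+
      define n where "n y = real (card {x \<in> X. F x y})" for y
      define Q where "Q = real_of_int q"
      define x where "x = real (card X)"
      have Q0: "Q > 0" using q0 by (simp add: Q_def)
      have s1: "(\<Sum>y\<in>K. n y) = x * Q"
      proof -
        have "(\<Sum>y\<in>K. n y) = real (\<Sum>x\<in>X. card {y \<in> K. F x y})"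
          unfolding n_def of_nat_sum[symmetric] by (simp only: sum_card_swap[OF finX fin])
        then show ?thesis by (simp add: deg Q_def x_def)
      qed
      have s2: "(\<Sum>y\<in>K. (n y)\<^sup>2) \<le> x * Q + x\<^sup>2"
      proof -
        have "(n y)\<^sup>2 = real (card {z \<in> X \<times> X. F (fst z) y \<and> F (snd z) y})" for y
        proof -
          have "{z \<in> X \<times> X. F (fst z) y \<and> F (snd z) y} = {x \<in> X. F x y} \<times> {x \<in> X. F x y}" by auto
          then show ?thesis by (simp add: n_def card_cartesian_product power2_eq_square)
        qed
        then have "(\<Sum>y\<in>K. (n y)\<^sup>2)
            = real (\<Sum>z\<in>X \<times> X. card {y \<in> K. F (fst z) y \<and> F (snd z) y})"
          using finX by (simp only: of_nat_sum[symmetric] sum_card_swap[OF finite_cartesian_product[OF finX finX] fin])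
        also have "\<dots> = (\<Sum>a\<in>X. \<Sum>b\<in>X. real (card {y \<in> K. F a y \<and> F b y}))"
          by (simp add: sum.cartesian_product case_prod_unfold)
        also have "\<dots> \<le> (\<Sum>a\<in>X. \<Sum>b\<in>X. (if a = b then Q else 0) + 1)"
        proof (intro sum_mono)
          fix a b assume "a \<in> X" "b \<in> X"
          then show "real (card {y \<in> K. F a y \<and> F b y}) \<le> (if a = b then Q else 0) + 1"
            using deg[of a] codeg[of a b] X(1) by (auto simp: Q_def)
        qed
        also have "\<dots> = x * Q + x\<^sup>2"
          using finX by (simp add: sum.distrib sum.delta' x_def power2_eq_square algebra_simps)
        finally show ?thesis .
      qed
      have "real (card Y) * x\<^sup>2 = (\<Sum>y\<in>Y. (Q * n y - x)\<^sup>2)"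
      proof -
        have "n y = 0" if "y \<in> Y" for y
        proof -
          have "{x \<in> X. F x y} = {}" using no that by blast
          then show ?thesis by (simp only: n_def card.empty of_nat_0)
        qed
        then show ?thesis by simp
      qed
      also have "\<dots> \<le> (\<Sum>y\<in>K. (Q * n y - x)\<^sup>2)"
        using Y(1) fin by (intro sum_mono2) auto
      also have "\<dots> = Q\<^sup>2 * (\<Sum>y\<in>K. (n y)\<^sup>2) - 2 * Q * x * (\<Sum>y\<in>K. n y) + real (card K) * x\<^sup>2"
      proof -
        have "(Q * n y - x)\<^sup>2 = Q\<^sup>2 * (n y)\<^sup>2 - 2 * Q * x * n y + x\<^sup>2" for y
          by (simp add: power2_eq_square algebra_simps)
        then show ?thesis
          by (simp only: sum.distrib sum_subtractf sum_distrib_left[symmetric] sum_constant)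
      qed
      also have "\<dots> \<le> Q\<^sup>2 * (x * Q + x\<^sup>2) - 2 * Q * x * (x * Q) + Q\<^sup>2 * x\<^sup>2"
        unfolding s1 cardK Q_def[symmetric] using s2 by (simp add: mult_left_mono)
      also have "\<dots> = Q ^ 3 * x" by (simp add: algebra_simps power2_eq_square power3_eq_cube)
      finally have *: "real (card Y) * x\<^sup>2 \<le> Q ^ 3 * x" .
      have lowX: "e * Q\<^sup>2 \<le> x" using X(2) by (simp add: cardK Q_def x_def)
      have lowY: "e * Q\<^sup>2 \<le> real (card Y)" using Y(2) by (simp add: cardK Q_def)
      have eQ: "0 < e * Q\<^sup>2" using assms Q0 by simp
      then have x0: "0 < x" using lowX by linarith
      \<comment> \<open>The variance bound amounts to \<open>|X| |Y| \<le> Q ^ 3\<close>, but both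
        sets have at least \<open>e * Q\<^sup>2\<close> elements and
        \<open>e\<^sup>2 * Q > 1\<close>.\<close>
      have "Q ^ 3 < Q ^ 3 * (e\<^sup>2 * Q)" using eq(2) Q0 by (simp add: Q_def)
      also have "\<dots> = (e * Q\<^sup>2) * (e * Q\<^sup>2)" by (simp add: power2_eq_square power3_eq_cube)
      also have "\<dots> \<le> real (card Y) * x"
        using lowX lowY eQ by (intro mult_mono) auto
      finally have "Q ^ 3 * x < real (card Y) * x * x" using x0 by simp
      then show False using * by (simp add: power2_eq_square mult.assoc)
    qed
  qed
qed

subsection \<open>Blowing up a fixed colouring\<close>

lemma card_residue_class_le:
  fixes n M i :: nat
  shows "card {v. v < n \<and> v mod M = i} \<le> n div M + 1"
proof -
  have "card {v. v < n \<and> v mod M = i} \<le> card {..n div M}"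
  proof (rule card_inj_on_le[of "\<lambda>v. v div M"])
    show "inj_on (\<lambda>v. v div M) {v. v < n \<and> v mod M = i}"
      by (rule inj_onI) (metis (mono_tags, lifting) div_mult_mod_eq mem_Collect_eq)
    show "(\<lambda>v. v div M) ` {v. v < n \<and> v mod M = i} \<subseteq> {..n div M}"
      by (auto intro: div_le_mono)
  qed simp
  then show ?thesis by simp
qed

text \<open>Vertex \<open>v\<close> goes to the class indexed by \<open>v mod card W\<close>. A
  red/purple clique meets each class at most once, hence embeds in \<open>W\<close>; a blue/purple
  clique projects to a set of at most \<open>a\<close> classes, each of size at most
  \<open>n div card W + 1\<close>.\<close>

lemma purple_counts_blow_up:
  fixes W :: "'a set" and R P :: "'a \<Rightarrow> 'a \<Rightarrow> bool"
  assumes fin: "finite W" and ne: "W \<noteq> {}"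
    and symR: "\<And>x y. R x y \<Longrightarrow> R y x" and symP: "\<And>x y. P x y \<Longrightarrow> P y x"
    and disj: "\<And>x y. R x y \<Longrightarrow> \<not> P x y"
    and irrefl: "\<And>x. x \<in> W \<Longrightarrow> \<not> R x x \<and> \<not> P x x"
    and clq: "\<And>T. T \<subseteq> W \<Longrightarrow> (\<And>x y. x \<in> T \<Longrightarrow> y \<in> T \<Longrightarrow> x \<noteq> y \<Longrightarrow> R x y \<or> P x y) \<Longrightarrow> card T < s"
    and ind: "\<And>T. T \<subseteq> W \<Longrightarrow> (\<And>x y. x \<in> T \<Longrightarrow> y \<in> T \<Longrightarrow> \<not> R x y) \<Longrightarrow> card T \<le> a"
    and a: "a * (n div card W + 1) < t"
  shows "\<exists>k\<in>purple_counts n s t. card {(x, y) \<in> W \<times> W. P x y} * (n div card W)\<^sup>2 \<le> 2 * k"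
proof -
  define M where "M = card W"
  have M: "M > 0" using fin ne by (simp add: M_def card_gt_0_iff)
  obtain e where e: "bij_betw e {0..<M} W" using ex_bij_betw_nat_finite[OF fin] M_def by blast
  define \<pi> where "\<pi> v = e (v mod M)" for v
  have \<pi>W: "\<pi> v \<in> W" for v using e M by (auto simp: \<pi>_def bij_betw_def)
  define D where "D r = {X. \<exists>u v. X = {u, v} \<and> u < n \<and> v < n \<and> u \<noteq> v \<and> r (\<pi> u) (\<pi> v)}"
    for r :: "'a \<Rightarrow> 'a \<Rightarrow> bool"
  have D: "{u, v} \<in> D r \<longleftrightarrow> u < n \<and> v < n \<and> u \<noteq> v \<and> r (\<pi> u) (\<pi> v)"
    if "\<And>x y. r x y \<Longrightarrow> r y x" for r u v
    using that by (auto simp: D_def doubleton_eq_iff)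
  have DR: "{u, v} \<in> D R \<longleftrightarrow> u < n \<and> v < n \<and> u \<noteq> v \<and> R (\<pi> u) (\<pi> v)" for u v
    by (rule D) (rule symR)
  have DP: "{u, v} \<in> D P \<longleftrightarrow> u < n \<and> v < n \<and> u \<noteq> v \<and> P (\<pi> u) (\<pi> v)" for u v
    by (rule D) (rule symP)
  have Dsub: "D r \<subseteq> [{..<n}]\<^bsup>2\<^esup>" for r by (auto simp: D_def nsets_def)
  have finD: "finite (D r)" for r
    using Dsub finite_imp_finite_nsets[of "{..<n}" 2] finite_subset by blast
  have disjD: "D R \<inter> D P = {}"
  proof (rule ccontr)
    assume "D R \<inter> D P \<noteq> {}"
    then obtain u v where "{u, v} \<in> D R" "{u, v} \<in> D P" by (auto simp: D_def)
    then show False using DR DP disj by blast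
  qed
  \<comment> \<open>Pairs inside one class fall into \<open>B\<close>, because neither relation
    holds between a class and itself.\<close>
  define B where "B = [{..<n}]\<^bsup>2\<^esup> - D R - D P"
  have "rbp_colouring n (D R) B (D P)"
    unfolding rbp_colouring_def B_def using Dsub disjD by blast
  moreover have "K_free n s (D R \<union> D P)"
    unfolding K_free_def
  proof
    assume "\<exists>S\<subseteq>{..<n}. card S = s \<and> clique S (D R \<union> D P)"
    then obtain S where S: "S \<subseteq> {..<n}" "card S = s" "clique S (D R \<union> D P)" by blast
    have adj: "R (\<pi> u) (\<pi> v) \<or> P (\<pi> u) (\<pi> v)" if "u \<in> S" "v \<in> S" "u \<noteq> v" for u v
      using S(3) that DR DP unfolding clique_def by blast
    have "inj_on \<pi> S"
      by (rule inj_onI) (metis adj irrefl \<pi>W)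
    moreover have "card (\<pi> ` S) < s"
    proof (rule clq)
      show "\<pi> ` S \<subseteq> W" using \<pi>W by blast
      show "R x y \<or> P x y" if "x \<in> \<pi> ` S" "y \<in> \<pi> ` S" "x \<noteq> y" for x y
        using that adj by blast
    qed
    ultimately show False using S(2) by (simp add: card_image)
  qed
  moreover have "K_free n t (B \<union> D P)"
    unfolding K_free_def
  proof
    assume "\<exists>S\<subseteq>{..<n}. card S = t \<and> clique S (B \<union> D P)"
    then obtain S where S: "S \<subseteq> {..<n}" "card S = t" "clique S (B \<union> D P)" by blast
    have non: "\<not> R (\<pi> u) (\<pi> v)" if "u \<in> S" "v \<in> S" for u v
    proof (cases "u = v")
      case True then show ?thesis using irrefl \<pi>W by blast
    next
      case False
      then have "{u, v} \<in> B \<union> D P" using S(3) that by (simp add: clique_def)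
      then have "{u, v} \<notin> D R" using disjD by (auto simp: B_def)
      then show ?thesis using False that S(1) DR by blast
    qed
    define T where "T = \<pi> ` S"
    have finS: "finite S" using S(1) finite_subset by blast
    have "card T \<le> a"
      by (rule ind) (use non \<pi>W in \<open>auto simp: T_def\<close>)
    have "S = (\<Union>x\<in>T. {v \<in> S. \<pi> v = x})" by (auto simp: T_def)
    then have "card S \<le> (\<Sum>x\<in>T. card {v \<in> S. \<pi> v = x})"
      using card_UN_le[of T "\<lambda>x. {v \<in> S. \<pi> v = x}"] finS by (simp add: T_def)
    also have "\<dots> \<le> (\<Sum>x\<in>T. n div M + 1)"
    proof (rule sum_mono)
      fix x assume "x \<in> T"
      then obtain v0 where v0: "x = \<pi> v0" by (auto simp: T_def)
      have "{v \<in> S. \<pi> v = x} \<subseteq> {v. v < n \<and> v mod M = v0 mod M}"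
      proof
        fix v assume v: "v \<in> {v \<in> S. \<pi> v = x}"
        then have "e (v mod M) = e (v0 mod M)" by (simp add: v0 \<pi>_def)
        then have "v mod M = v0 mod M"
          using e M by (auto simp: bij_betw_def dest!: inj_onD)
        then show "v \<in> {v. v < n \<and> v mod M = v0 mod M}" using v S(1) by auto
      qed
      then have "card {v \<in> S. \<pi> v = x} \<le> card {v. v < n \<and> v mod M = v0 mod M}"
        by (intro card_mono) auto
      then show "card {v \<in> S. \<pi> v = x} \<le> n div M + 1"
        using card_residue_class_le[of n M "v0 mod M"] by linarith
    qed
    also have "\<dots> \<le> a * (n div M + 1)" using \<open>card T \<le> a\<close> by (simp only: sum_constant of_nat_id mult_le_mono1)
    also have "\<dots> < t" using a by (simp add: M_def)
    finally show False using S(2) by simp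
  qed
  ultimately have "card (D P) \<in> purple_counts n s t"
    unfolding purple_counts_def by blast
  moreover have "card {(x, y) \<in> W \<times> W. P x y} * (n div M)\<^sup>2 \<le> 2 * card (D P)"
  proof -
    define Q where "Q = n div M"
    \<comment> \<open>Each purple edge has one orientation in \<open>O1\<close> and one in
      \<open>O2\<close>, whence the factor 2.\<close>
    define O1 where "O1 = {(u, v). u < n \<and> v < n \<and> u < v \<and> P (\<pi> u) (\<pi> v)}"
    define O2 where "O2 = {(u, v). u < n \<and> v < n \<and> v < u \<and> P (\<pi> u) (\<pi> v)}"
    have finO: "finite O1" "finite O2"
      by (rule finite_subset[of _ "{..<n} \<times> {..<n}"]; auto simp: O1_def O2_def)+
    have "card O1 \<le> card (D P)" "card O2 \<le> card (D P)"
      by (rule card_inj_on_le[of "\<lambda>(u, v). {u, v}" _ "D P"];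
          auto simp: O1_def O2_def inj_on_def doubleton_eq_iff DP finD)+
    moreover have "card ({(x, y) \<in> W \<times> W. P x y} \<times> ({..<Q} \<times> {..<Q})) \<le> card (O1 \<union> O2)"
    proof (rule card_inj_on_le)
      define ix where "ix = inv_into {0..<M} e"
      have ix: "ix x < M" "e (ix x) = x" if "x \<in> W" for x
        using that e inv_into_into[of x e "{0..<M}"] f_inv_into_f[of x e "{0..<M}"]
        by (auto simp: ix_def bij_betw_def)
      \<comment> \<open>\<open>ix x + M * i\<close> is the \<open>i\<close>-th vertex of class
        \<open>x\<close>. Only the \<open>Q\<close> complete rounds of residues are used, so that
        all these vertices are below \<open>n\<close>.\<close>
      let ?f = "\<lambda>((x, y), (i, j)). (ix x + M * i, ix y + M * j)"
      have low: "ix x + M * i < n" if "x \<in> W" "i < Q" for x i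
      proof -
        have "ix x + M * i < M * (i + 1)" using ix that by simp
        also have "\<dots> \<le> M * Q" using that by (intro mult_le_mono2) simp
        also have "\<dots> \<le> n" by (simp add: Q_def)
        finally show ?thesis .
      qed
      have proj: "\<pi> (ix x + M * i) = x" if "x \<in> W" for x i using ix that by (simp add: \<pi>_def)
      show "inj_on ?f ({(x, y) \<in> W \<times> W. P x y} \<times> ({..<Q} \<times> {..<Q}))"
      proof -
        have "x = x' \<and> i = i'" if "ix x + M * i = ix x' + M * i'" "x \<in> W" "x' \<in> W" for x x' i i'
        proof -
          have "x = x'" using proj that by metis
          then show ?thesis using that M by simp
        qed
        then show ?thesis by (fastforce simp: inj_on_def)
      qed
      show "?f ` ({(x, y) \<in> W \<times> W. P x y} \<times> ({..<Q} \<times> {..<Q})) \<subseteq> O1 \<union> O2"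
      proof
        fix z assume "z \<in> ?f ` ({(x, y) \<in> W \<times> W. P x y} \<times> ({..<Q} \<times> {..<Q}))"
        then obtain x y i j where z: "x \<in> W" "y \<in> W" "P x y" "i < Q" "j < Q"
            "z = (ix x + M * i, ix y + M * j)"
          by auto
        have "ix x + M * i \<noteq> ix y + M * j" using proj z irrefl by metis
        then show "z \<in> O1 \<union> O2" using z low proj by (auto simp: O1_def O2_def)
      qed
      show "finite (O1 \<union> O2)" using finO by simp
    qed
    ultimately show ?thesis
      using card_Un_le[of O1 O2] by (simp add: card_cartesian_product Q_def power2_eq_square)
  qed
  ultimately show ?thesis unfolding M_def by blast
qed

section \<open>Joins of tight graphs and the fixed colouring\<close>

text \<open>The vertex \<open>(i, v, j)\<close> is the \<open>j\<close>-th of \<open>w v\<close>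
  nonadjacent twins of \<open>v\<close> in copy \<open>i\<close>; twins turn weights into
  cardinalities. A clique has at most two vertices per copy, an independent set lies in one copy,
  and every degree is \<open>(l - 1) * N + d\<close> out of \<open>l * N\<close>.\<close>

lemma join_of_tight_graphs:
  assumes c: "tight_ratio c" and l: "l \<ge> 1"
  obtains U :: "(nat \<times> nat \<times> nat) set" and adj d where
    "finite U" "U \<noteq> {}" "\<And>x y. adj x y \<Longrightarrow> adj y x" "\<And>x. x \<in> U \<Longrightarrow> \<not> adj x x"
    "\<And>T. T \<subseteq> U \<Longrightarrow> (\<And>x y. x \<in> T \<Longrightarrow> y \<in> T \<Longrightarrow> x \<noteq> y \<Longrightarrow> adj x y) \<Longrightarrow> card T < 2 * l + 1"
    "\<And>T. T \<subseteq> U \<Longrightarrow> (\<And>x y. x \<in> T \<Longrightarrow> y \<in> T \<Longrightarrow> \<not> adj x y) \<Longrightarrow> card T \<le> d"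
    "real d = c / real l * real (card U)"
    "real (card {(x, y) \<in> U \<times> U. adj x y})
      = ((real l - 1) / real l + c / real l) * (real (card U))\<^sup>2"
proof -
  obtain V :: "nat set" and E w d where G: "tight_graph V E w d"
    and pos: "sum w V > 0" and c: "c = real d / real (sum w V)"
    using c unfolding tight_ratio_def by blast
  note finV = tight_graphD(1)[OF G] and sym = tight_graphD(2)[OF G]
    and tri = tight_graphD(3)[OF G] and deg = tight_graphD(4)[OF G] and ind = tight_graphD(5)[OF G]
  define N where "N = sum w V"
  define L where "L A = Sigma A (\<lambda>v. {..<w v})" for A
  have cardL: "card (L A) = sum w A" and finL: "finite (L A)" if "A \<subseteq> V" for A
    using finite_subset[OF that finV] by (simp_all add: L_def)
  define U where "U = {..<l} \<times> L V"
  define adj where "adj = (\<lambda>(i, v, j :: nat) (i', v', j' :: nat). i \<noteq> (i' :: nat) \<or> E v v')"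
  have finU: "finite U" by (simp add: U_def finL)
  have cardU: "card U = l * N" by (simp add: U_def cardL N_def card_cartesian_product)
  show ?thesis
  proof (rule that)
    show "finite U" by (rule finU)
    show "U \<noteq> {}" using cardU pos l by (auto simp: N_def)
    show "adj y x" if "adj x y" for x y
      using that sym by (cases x; cases y) (auto simp: adj_def)
    show "\<not> adj x x" if "x \<in> U" for x
      using that tri by (cases x) (auto simp: adj_def U_def L_def)
    show "card T < 2 * l + 1"
      if T: "T \<subseteq> U" "\<And>x y. x \<in> T \<Longrightarrow> y \<in> T \<Longrightarrow> x \<noteq> y \<Longrightarrow> adj x y" for T
    proof -
      have le2: "card {x \<in> T. fst x = i} \<le> 2" for i
      proof (rule ccontr)
        assume "\<not> ?thesis"
        then have "3 \<le> card {x \<in> T. fst x = i}" by simp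
        then obtain Z where Z: "Z \<subseteq> {x \<in> T. fst x = i}" "card Z = 3"
          by (meson obtain_subset_with_card_n)
        then obtain x y z where xyz: "Z = {x, y, z}" "x \<noteq> y" "y \<noteq> z" "x \<noteq> z"
          by (auto simp: card_3_iff)
        have mem: "x \<in> T" "y \<in> T" "z \<in> T" "fst x = i" "fst y = i" "fst z = i"
          using Z(1) xyz(1) by auto
        then have "adj x y" "adj y z" "adj x z" using T(2) xyz by blast+
        then have "E (fst (snd x)) (fst (snd y))" "E (fst (snd y)) (fst (snd z))"
            "E (fst (snd x)) (fst (snd z))"
          using mem by (auto simp: adj_def case_prod_unfold)
        moreover have "fst (snd x) \<in> V" "fst (snd y) \<in> V" "fst (snd z) \<in> V"
          using mem T(1) by (auto simp: U_def L_def)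
        ultimately show False using tri by blast
      qed
      have "T = (\<Union>i<l. {x \<in> T. fst x = i})" using T(1) by (auto simp: U_def)
      then have "card T \<le> (\<Sum>i<l. card {x \<in> T. fst x = i})"
        using card_UN_le[of "{..<l}" "\<lambda>i. {x \<in> T. fst x = i}"] by simp
      also have "\<dots> \<le> (\<Sum>i<l. 2)" by (intro sum_mono le2)
      finally show ?thesis by simp
    qed
    show "card T \<le> d"
      if T: "T \<subseteq> U" "\<And>x y. x \<in> T \<Longrightarrow> y \<in> T \<Longrightarrow> \<not> adj x y" for T
    proof (cases "T = {}")
      case False
      then obtain i v0 j0 where i: "(i, v0, j0) \<in> T" by auto
      define S where "S = (\<lambda>x. fst (snd x)) ` T"
      have SV: "S \<subseteq> V" using T(1) by (auto simp: S_def U_def L_def)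
      have same: "fst x = i" if "x \<in> T" for x
        using T(2)[OF that i] by (auto simp: adj_def case_prod_unfold)
      have "\<not> E x y" if "x \<in> S" "y \<in> S" for x y
      proof -
        obtain x' y' where "x' \<in> T" "y' \<in> T" "x = fst (snd x')" "y = fst (snd y')"
          using \<open>x \<in> S\<close> \<open>y \<in> S\<close> unfolding S_def by blast
        then show ?thesis using T(2)[of x' y'] by (simp add: adj_def case_prod_unfold)
      qed
      then have "sum w S \<le> d" by (rule ind[OF SV])
      moreover have "T \<subseteq> {i} \<times> L S"
        using T(1) same by (force simp: S_def L_def U_def)
      then have "card T \<le> card ({i} \<times> L S)" by (intro card_mono) (auto simp: finL SV)
      ultimately show ?thesis by (simp add: card_cartesian_product cardL[OF SV])
    qed simp
    show "real d = c / real l * real (card U)"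
      using pos l unfolding c N_def[symmetric] by (simp add: cardU)
    have dg: "card {y \<in> U. adj x y} = (l - 1) * N + d" if x: "x \<in> U" for x
    proof -
      obtain i v j where [simp]: "x = (i, v, j)" by (cases x)
      have v: "v \<in> V" "i < l" using x by (auto simp: U_def L_def)
      have "{y \<in> U. adj x y} = ({..<l} - {i}) \<times> L V \<union> {i} \<times> L {u \<in> V. E v u}"
        using v by (auto simp: U_def L_def adj_def)
      moreover have "card (({..<l} - {i}) \<times> L V \<union> {i} \<times> L {u \<in> V. E v u})
          = card (({..<l} - {i}) \<times> L V) + card ({i} \<times> L {u \<in> V. E v u})"
        by (intro card_Un_disjoint) (auto simp: finL)
      ultimately show ?thesis
        using v by (simp add: card_cartesian_product cardL N_def deg)
    qed
    have "card {(x, y) \<in> U \<times> U. adj x y} = card U * ((l - 1) * N + d)"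
      unfolding card_prod_by_fst[OF finU] by (simp add: dg)
    then have "real (card {(x, y) \<in> U \<times> U. adj x y})
        = real l * real N * ((real l - 1) * real N + real d)"
      using l by (simp add: cardU of_nat_diff)
    also have "\<dots> = ((real l - 1) / real l + c / real l) * (real (card U))\<^sup>2"
      using l pos by (simp add: cardU c N_def[symmetric] field_simps power2_eq_square)
    finally show "real (card {(x, y) \<in> U \<times> U. adj x y})
      = ((real l - 1) / real l + c / real l) * (real (card U))\<^sup>2" .
  qed
qed

text \<open>Each vertex of the join is replaced by a copy of \<open>K\<close>; between adjacent
  copies \<open>F\<close> selects the red pairs and all others are purple. Cliques still project
  injectively to the join.\<close>

lemma dense_fixed_colouring:
  fixes c \<epsilon> :: real
  assumes l: "l \<ge> 1" and c: "0 < c" "c < 1 / (3 * real l)" and \<epsilon>: "0 < \<epsilon>"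
  obtains W :: "((nat \<times> nat \<times> nat) \<times> (int \<times> int)) set" and R P a where
    "finite W" "W \<noteq> {}" "\<And>x y. R x y \<Longrightarrow> R y x" "\<And>x y. P x y \<Longrightarrow> P y x"
    "\<And>x y. R x y \<Longrightarrow> \<not> P x y" "\<And>x. x \<in> W \<Longrightarrow> \<not> R x x \<and> \<not> P x x"
    "\<And>T. T \<subseteq> W \<Longrightarrow> (\<And>x y. x \<in> T \<Longrightarrow> y \<in> T \<Longrightarrow> x \<noteq> y \<Longrightarrow> R x y \<or> P x y) \<Longrightarrow> card T < 2 * l + 1"
    "\<And>T. T \<subseteq> W \<Longrightarrow> (\<And>x y. x \<in> T \<Longrightarrow> y \<in> T \<Longrightarrow> \<not> R x y) \<Longrightarrow> card T \<le> a"
    "real a < c * real (card W)"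
    "((real l - 1) / real l + c - \<epsilon>) * (real (card W))\<^sup>2 \<le> real (card {(x, y) \<in> W \<times> W. P x y})"
proof -
  have l0: "real l > 0" using l by simp
  \<comment> \<open>The first term keeps the interval for the ratio away from 0, as density
    requires; the second keeps the loss in density within \<open>\<epsilon> / 2\<close>.\<close>
  define c0 where "c0 = max (c / 2) (c - \<epsilon> / 2)"
  have c0: "0 < c0" "c0 < c" "c - \<epsilon> / 2 \<le> c0" using c \<epsilon> by (auto simp: c0_def)
  have "real l * c \<le> 1 / 3" using c l0 by (simp add: field_simps)
  then obtain x where x: "tight_ratio x" "real l * c0 < x" "x < real l * c"
    using tight_ratio_dense[of "real l * c0" "real l * c"] c0 l0 by auto
  define c' where "c' = x / real l"
  have c': "c0 < c'" "c' < c" using x l0 by (auto simp: c'_def field_simps)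
  define e where "e = min (\<epsilon> / 2) ((c - c') / 2)"
  have e: "0 < e" "e \<le> \<epsilon> / 2" "c' + e < c" using \<epsilon> c' by (auto simp: e_def min_def field_simps)
  obtain U :: "(nat \<times> nat \<times> nat) set" and adj d where U: "finite U" "U \<noteq> {}"
    and adj: "\<And>x y. adj x y \<Longrightarrow> adj y x" "\<And>x. x \<in> U \<Longrightarrow> \<not> adj x x"
    and clq: "\<And>T. T \<subseteq> U \<Longrightarrow> (\<And>x y. x \<in> T \<Longrightarrow> y \<in> T \<Longrightarrow> x \<noteq> y \<Longrightarrow> adj x y) \<Longrightarrow> card T < 2 * l + 1"
    and ind: "\<And>T. T \<subseteq> U \<Longrightarrow> (\<And>x y. x \<in> T \<Longrightarrow> y \<in> T \<Longrightarrow> \<not> adj x y) \<Longrightarrow> card T \<le> d"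
    and d: "real d = c' * real (card U)"
    and pairs: "real (card {(x, y) \<in> U \<times> U. adj x y}) = ((real l - 1) / real l + c') * (real (card U))\<^sup>2"
    by (fact join_of_tight_graphs[OF x(1) l, folded c'_def])
  obtain K :: "(int \<times> int) set" and F where K: "finite K" "K \<noteq> {}" and F: "\<And>x y. F x y \<longleftrightarrow> F y x"
    "real (card {(x, y) \<in> K \<times> K. F x y}) \<le> e * (real (card K))\<^sup>2"
    "\<And>X Y. X \<subseteq> K \<Longrightarrow> Y \<subseteq> K \<Longrightarrow> e * real (card K) \<le> real (card X) \<Longrightarrow>
      e * real (card K) \<le> real (card Y) \<Longrightarrow> \<exists>x\<in>X. \<exists>y\<in>Y. F x y"
    by (fact sparse_symmetric_relation[OF e(1)])
  define u k where "u = real (card U)" and "k = real (card K)"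
  have uk: "0 < u" "0 < k" using U K by (simp_all add: u_def k_def card_gt_0_iff)
  define W where "W = U \<times> K"
  define R P where "R x y \<longleftrightarrow> adj (fst x) (fst y) \<and> F (snd x) (snd y)"
    and "P x y \<longleftrightarrow> adj (fst x) (fst y) \<and> \<not> F (snd x) (snd y)"
    for x y :: "(nat \<times> nat \<times> nat) \<times> (int \<times> int)"
  have finW: "finite W" using U K by (simp add: W_def)
  have cardW: "real (card W) = u * k" by (simp add: W_def u_def k_def card_cartesian_product)
  \<comment> \<open>Classes holding at least \<open>e * k\<close> vertices of a red-free set are
    pairwise nonadjacent, so there are at most \<open>d\<close> of them, contributing
    \<open>d * k = c' * u * k\<close>; all other classes together contribute at most
    \<open>e * u * k\<close>.\<close>
  define a where "a = nat \<lfloor>(c' + e) * (u * k)\<rfloor>"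
  have pos: "0 \<le> (c' + e) * (u * k)" using c' c0 e uk by simp
  show ?thesis
  proof (rule that)
    show "finite W" by (rule finW)
    show "W \<noteq> {}" using U K by (simp add: W_def)
    show "R y x" if "R x y" for x y using that adj(1) F(1) unfolding R_def by blast
    show "P y x" if "P x y" for x y using that adj(1) F(1) unfolding P_def by blast
    show "\<not> P x y" if "R x y" for x y using that by (simp add: R_def P_def)
    show "\<not> R x x \<and> \<not> P x x" if "x \<in> W" for x
      using that adj(2) by (auto simp: R_def P_def W_def)
    show "card T < 2 * l + 1"
      if T: "T \<subseteq> W" "\<And>x y. x \<in> T \<Longrightarrow> y \<in> T \<Longrightarrow> x \<noteq> y \<Longrightarrow> R x y \<or> P x y" for T
    proof -
      have adjT: "adj (fst x) (fst y)" if "x \<in> T" "y \<in> T" "x \<noteq> y" for x y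
        using T(2)[OF that] by (auto simp: R_def P_def)
      have inj: "inj_on fst T"
      proof (rule inj_onI)
        fix x y assume xy: "x \<in> T" "y \<in> T" "fst x = fst y"
        have "\<not> adj (fst x) (fst y)" using xy adj(2) T(1) by (auto simp: W_def)
        then show "x = y" using adjT xy by blast
      qed
      have "card (fst ` T) < 2 * l + 1"
      proof (rule clq)
        show "fst ` T \<subseteq> U" using T(1) by (auto simp: W_def)
        show "adj x y" if "x \<in> fst ` T" "y \<in> fst ` T" "x \<noteq> y" for x y
          using that adjT by blast
      qed
      then show ?thesis by (simp add: card_image[OF inj])
    qed
    show "card T \<le> a"
      if T: "T \<subseteq> W" "\<And>x y. x \<in> T \<Longrightarrow> y \<in> T \<Longrightarrow> \<not> R x y" for T
    proof -
      define X where "X v = {z. (v, z) \<in> T}" for v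
      have XK: "X v \<subseteq> K" for v using T(1) by (auto simp: X_def W_def)
      have finX: "finite (X v)" for v using XK K(1) finite_subset by blast
      define H where "H = {v \<in> U. e * k \<le> real (card (X v))}"
      have "\<not> adj v v'" if v: "v \<in> H" "v' \<in> H" for v v'
      proof -
        obtain z z' where "z \<in> X v" "z' \<in> X v'" "F z z'"
          using F(3)[OF XK XK, of v v'] v by (auto simp: H_def k_def)
        then show ?thesis using T(2)[of "(v, z)" "(v', z')"] by (auto simp: X_def R_def)
      qed
      then have H: "card H \<le> d" by (intro ind) (auto simp: H_def)
      have "T = Sigma U X" using T(1) by (auto simp: X_def W_def)
      then have "real (card T) = (\<Sum>v\<in>U. real (card (X v)))"
        using U(1) finX by simp
      also have "\<dots> \<le> (\<Sum>v\<in>U. (if v \<in> H then k else 0) + e * k)"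
      proof (rule sum_mono)
        fix v assume v: "v \<in> U"
        show "real (card (X v)) \<le> (if v \<in> H then k else 0) + e * k"
        proof (cases "v \<in> H")
          case True
          have "card (X v) \<le> card K" using K(1) XK by (intro card_mono)
          moreover have "0 \<le> e * k" using e uk by simp
          ultimately show ?thesis using True unfolding k_def by simp
        qed (use v in \<open>auto simp: H_def\<close>)
      qed
      also have "\<dots> = real (card H) * k + u * (e * k)"
      proof -
        have "{v \<in> U. v \<in> H} = H" by (auto simp: H_def)
        then have "(\<Sum>v\<in>U. if v \<in> H then k else 0) = real (card H) * k"
          using sum.inter_filter[OF U(1), of "\<lambda>_. k" "\<lambda>v. v \<in> H"] by simp
        then show ?thesis by (simp add: sum.distrib u_def)
      qed
      also have "\<dots> \<le> real d * k + u * (e * k)" using H uk by simp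
      also have "\<dots> = (c' + e) * (u * k)" by (simp add: d u_def algebra_simps)
      finally show ?thesis by (simp add: a_def le_nat_floor)
    qed
    have "real a \<le> (c' + e) * (u * k)"
      unfolding a_def using pos by (rule of_nat_floor)
    also have "\<dots> < c * (u * k)" using e(3) uk by simp
    finally show "real a < c * real (card W)" by (simp add: cardW)
    define AU FK where "AU = {(x, y) \<in> U \<times> U. adj x y}" and "FK = {(x, y) \<in> K \<times> K. F x y}"
    define \<kappa> where "\<kappa> = (real l - 1) / real l + c'"
    have \<kappa>1: "\<kappa> \<le> 1"
    proof -
      have "c' \<le> 1 / (3 * real l)" using c' c by linarith
      also have "\<dots> \<le> 1 / real l" using l0 by (simp add: field_simps)
      finally show ?thesis using l0 by (simp add: \<kappa>_def diff_divide_distrib)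
    qed
    have "card {(x, y) \<in> W \<times> W. P x y} = card (AU \<times> (K \<times> K - FK))"
    proof (rule bij_betw_same_card)
      show "bij_betw (\<lambda>((x, i), (y, j)). ((x, y), (i, j))) {(x, y) \<in> W \<times> W. P x y} (AU \<times> (K \<times> K - FK))"
        by (rule bij_betw_byWitness[where f' = "\<lambda>((x, y), (i, j)). ((x, i), (y, j))"])
          (auto simp: W_def AU_def FK_def P_def)
    qed
    also have "real (card (AU \<times> (K \<times> K - FK))) = real (card AU) * (k\<^sup>2 - real (card FK))"
    proof -
      have sub: "FK \<subseteq> K \<times> K" by (auto simp: FK_def)
      have finKK: "finite (K \<times> K)" using K(1) by simp
      have "card (K \<times> K - FK) = card (K \<times> K) - card FK"
        using sub finKK finite_subset by (intro card_Diff_subset) blast+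
      moreover have "card FK \<le> card (K \<times> K)" using sub finKK by (intro card_mono)
      ultimately show ?thesis
        by (simp add: card_cartesian_product k_def of_nat_diff power2_eq_square)
    qed
    finally have eq: "real (card {(x, y) \<in> W \<times> W. P x y}) = \<kappa> * u\<^sup>2 * (k\<^sup>2 - real (card FK))"
      using pairs by (simp add: AU_def \<kappa>_def u_def)
    \<comment> \<open>Half of \<open>\<epsilon>\<close> covers the gap between \<open>c'\<close> and
      \<open>c\<close>, the other half the proportion \<open>e\<close> of pairs lost to red. The
      bound \<open>\<kappa> \<le> 1\<close> turns the relative loss \<open>\<kappa> * e\<close> into
      an absolute one.\<close>
    have "((real l - 1) / real l + c - \<epsilon>) * (real (card W))\<^sup>2 \<le> (\<kappa> - e) * (u * k)\<^sup>2"
      unfolding cardW using c' c0 e by (intro mult_right_mono) (auto simp: \<kappa>_def)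
    also have "\<dots> \<le> (\<kappa> - \<kappa> * e) * (u * k)\<^sup>2"
      using \<kappa>1 e by (intro mult_right_mono) (auto simp: mult_left_le_one_le mult_le_cancel_right1)
    also have "\<dots> = \<kappa> * u\<^sup>2 * (k\<^sup>2 - e * k\<^sup>2)" by (simp add: algebra_simps power_mult_distrib)
    also have "\<dots> \<le> \<kappa> * u\<^sup>2 * (k\<^sup>2 - real (card FK))"
    proof (rule mult_left_mono)
      have "0 \<le> \<kappa>" using l c' c0 by (simp add: \<kappa>_def)
      then show "0 \<le> \<kappa> * u\<^sup>2" by simp
    qed (use F(2) in \<open>simp add: FK_def k_def\<close>)
    finally show "((real l - 1) / real l + c - \<epsilon>) * (real (card W))\<^sup>2
      \<le> real (card {(x, y) \<in> W \<times> W. P x y})" using eq by simp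
  qed
qed

section \<open>Passage to large n\<close>

lemma eventually_g_lower_bound:
  fixes c \<epsilon> :: real
  assumes l: "l \<ge> 1" and c: "0 < c" "c < 1 / (3 * real l)" and \<epsilon>: "0 < \<epsilon>"
  shows "\<forall>\<^sub>F n in sequentially. n < ramsey_number (2 * l + 1) (nat \<lceil>c * real n\<rceil>) \<and>
    ((real l - 1) / real l + c - \<epsilon>) * ((real n)\<^sup>2 / 2)
      \<le> real (g n (2 * l + 1) (nat \<lceil>c * real n\<rceil>))"
proof -
  define \<kappa> where "\<kappa> = (real l - 1) / real l + c"
  have "0 < \<epsilon> / 2" using \<epsilon> by simp
  obtain W :: "((nat \<times> nat \<times> nat) \<times> (int \<times> int)) set" and R P a where
    W: "finite W" "W \<noteq> {}" "\<And>x y. R x y \<Longrightarrow> R y x" "\<And>x y. P x y \<Longrightarrow> P y x"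
    "\<And>x y. R x y \<Longrightarrow> \<not> P x y" "\<And>x. x \<in> W \<Longrightarrow> \<not> R x x \<and> \<not> P x x"
    "\<And>T. T \<subseteq> W \<Longrightarrow> (\<And>x y. x \<in> T \<Longrightarrow> y \<in> T \<Longrightarrow> x \<noteq> y \<Longrightarrow> R x y \<or> P x y) \<Longrightarrow> card T < 2 * l + 1"
    "\<And>T. T \<subseteq> W \<Longrightarrow> (\<And>x y. x \<in> T \<Longrightarrow> y \<in> T \<Longrightarrow> \<not> R x y) \<Longrightarrow> card T \<le> a"
    and a: "real a < c * real (card W)"
    and dens: "(\<kappa> - \<epsilon> / 2) * (real (card W))\<^sup>2 \<le> real (card {(x, y) \<in> W \<times> W. P x y})"
    by (fact dense_fixed_colouring[OF l c \<open>0 < \<epsilon> / 2\<close>, folded \<kappa>_def])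
  define M where "M = card W"
  define D where "D = card {(x, y) \<in> W \<times> W. P x y}"
  have M: "0 < real M" using W(1,2) by (simp add: M_def card_gt_0_iff)
  have DM: "real D \<le> (real M)\<^sup>2"
  proof -
    have "D \<le> card (W \<times> W)" unfolding D_def using W(1) by (intro card_mono) auto
    then show ?thesis
      by (simp add: M_def card_cartesian_product power2_eq_square flip: of_nat_mult)
  qed
  have \<delta>: "0 < c - real a / real M" using a M by (simp add: M_def field_simps)
  show ?thesis
  proof (rule eventually_mono)
    \<comment> \<open>The first threshold gives \<open>a * (n / M + 1) < c * n\<close>, absorbing
      the extra vertex per class; the second makes the rounding loss \<open>2 * n * M\<close> at
      most \<open>\<epsilon> * n\<^sup>2 / 2\<close>; the third makes \<open>n / M - 1\<close>
      nonnegative, so that it can be squared.\<close>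
    show "\<forall>\<^sub>F n in sequentially. real a / (c - real a / real M) < real n \<and> 4 * real M / \<epsilon> \<le> real n \<and> M \<le> n"
      using filterlim_real_sequentially eventually_gt_at_top eventually_ge_at_top
      by (intro eventually_conj eventually_ge_at_top filterlim_at_top_dense[THEN iffD1, rule_format]
          filterlim_at_top[THEN iffD1, rule_format]) auto
  next
    fix n assume n: "real a / (c - real a / real M) < real n \<and> 4 * real M / \<epsilon> \<le> real n \<and> M \<le> n"
    define t where "t = nat \<lceil>c * real n\<rceil>"
    have "real (a * (n div M + 1)) \<le> real a * (real n / real M + 1)"
      unfolding of_nat_mult by (intro mult_left_mono) (simp_all add: of_nat_div_le_of_nat)
    also have "\<dots> < c * real n"
    proof -
      have "real a < real n * (c - real a / real M)"
        using n pos_divide_less_eq[OF \<delta>] by blast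
      then show ?thesis by (simp add: algebra_simps)
    qed
    also have "\<dots> \<le> real t" unfolding t_def by (rule real_nat_ceiling_ge)
    finally have "a * (n div card W + 1) < t" by (simp only: of_nat_less_iff M_def)
    from purple_counts_blow_up[OF W this]
    obtain k where k: "k \<in> purple_counts n (2 * l + 1) t" "D * (n div M)\<^sup>2 \<le> 2 * k"
      unfolding D_def M_def by (rule bexE)
    have kg: "k \<le> g n (2 * l + 1) t"
      unfolding g_def using k(1) by (intro Max_ge finite_purple_counts)
    have lin: "(real n)\<^sup>2 / (real M)\<^sup>2 - 2 * real n / real M \<le> (real (n div M))\<^sup>2"
    proof -
      have "real n / real M - 1 \<le> real (n div M)"
      proof -
        have "n < M * (n div M + 1)"
          using M dividend_less_times_div[of M n] by simp
        then have "real n < real M * (real (n div M) + 1)"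
          by (metis of_nat_1 of_nat_add of_nat_less_iff of_nat_mult)
        then show ?thesis using M by (simp add: field_simps)
      qed
      moreover have "0 \<le> real n / real M - 1" using n M by (simp add: field_simps)
      ultimately have "(real n / real M - 1)\<^sup>2 \<le> (real (n div M))\<^sup>2" by (rule power_mono)
      then show ?thesis by (simp add: power2_diff power_divide)
    qed
    have "(\<kappa> - \<epsilon>) * (real n)\<^sup>2 \<le> (\<kappa> - \<epsilon> / 2) * (real n)\<^sup>2 - 2 * real n * real M"
    proof -
      have "4 * real M * real n \<le> \<epsilon> * real n * real n"
        using n \<epsilon> by (intro mult_right_mono) (auto simp: divide_le_eq mult.commute)
      then show ?thesis by (simp add: algebra_simps power2_eq_square)
    qed
    \<comment> \<open>In the main term the density of \<open>W\<close> enters, while in the rounding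
      term the trivial \<open>D \<le> M\<^sup>2\<close> suffices.\<close>
    also have "\<dots> \<le> real D * ((real n)\<^sup>2 / (real M)\<^sup>2) - real D * (2 * real n / real M)"
    proof (rule diff_mono)
      have "(\<kappa> - \<epsilon> / 2) * (real M)\<^sup>2 * ((real n)\<^sup>2 / (real M)\<^sup>2) \<le> real D * ((real n)\<^sup>2 / (real M)\<^sup>2)"
        using dens unfolding M_def[symmetric] D_def[symmetric] by (intro mult_right_mono) auto
      then show "(\<kappa> - \<epsilon> / 2) * (real n)\<^sup>2 \<le> real D * ((real n)\<^sup>2 / (real M)\<^sup>2)" using M by simp
      have "real D * (2 * real n / real M) \<le> (real M)\<^sup>2 * (2 * real n / real M)"
        using DM by (intro mult_right_mono) auto
      then show "real D * (2 * real n / real M) \<le> 2 * real n * real M"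
        using M by (simp add: power2_eq_square mult.commute)
    qed
    also have "\<dots> \<le> real D * (real (n div M))\<^sup>2"
      using mult_left_mono[OF lin, of "real D"] by (simp add: right_diff_distrib)
    also have "\<dots> = real (D * (n div M)\<^sup>2)" by simp
    also have "\<dots> \<le> real (2 * k)" using k(2) by (simp only: of_nat_le_iff)
    finally have "(\<kappa> - \<epsilon>) * ((real n)\<^sup>2 / 2) \<le> real k" by simp
    \<comment> \<open>The colouring just built witnesses that \<open>n\<close> lies below the Ramsey
      number, so the maximum defining \<open>g\<close> is meaningful.\<close>
    moreover have "n < ramsey_number (2 * l + 1) t"
      using k(1) purple_counts_nonempty_iff by blast
    ultimately show "n < ramsey_number (2 * l + 1) (nat \<lceil>c * real n\<rceil>) \<and>
      ((real l - 1) / real l + c - \<epsilon>) * ((real n)\<^sup>2 / 2)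
        \<le> real (g n (2 * l + 1) (nat \<lceil>c * real n\<rceil>))"
      using kg by (simp add: \<kappa>_def t_def)
  qed
qed

theorem theorem5p1:
  fixes l :: nat and c :: real
  assumes "l \<ge> 1" and "0 < c" and "c < 1 / (3 * real l)"
  shows "\<exists>\<epsilon> :: nat \<Rightarrow> real. \<epsilon> \<in> o(\<lambda>_. 1) \<and>
    (\<forall>\<^sub>F n in sequentially.
       n < ramsey_number (2 * l + 1) (nat \<lceil>c * real n\<rceil>) \<and>
       real (g_real n (real (2 * l + 1)) (c * real n)) \<ge>
         ((real l - 1) / real l + c + \<epsilon> n) * ((real n)\<^sup>2 / 2))"
proof -
  define \<kappa> where "\<kappa> = (real l - 1) / real l + c"
  define G where "G n = real (g n (2 * l + 1) (nat \<lceil>c * real n\<rceil>))" for n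
  have G: "real (g_real n (real (2 * l + 1)) (c * real n)) = G n" for n
    unfolding g_real_def G_def by (simp only: ceiling_of_nat nat_int)
  \<comment> \<open>The actual deviation, cut off at 0 since only a lower bound is available. The
    inequality then holds by construction, and the content moves to \<open>\<epsilon>\<close> being
    \<open>o(1)\<close>.\<close>
  define \<epsilon> where "\<epsilon> n = min 0 (G n / ((real n)\<^sup>2 / 2) - \<kappa>)" for n
  have "\<epsilon> \<in> o(\<lambda>_. 1)"
  proof (rule landau_o.smallI)
    fix \<eta> :: real assume \<eta>: "0 < \<eta>"
    show "\<forall>\<^sub>F n in sequentially. norm (\<epsilon> n) \<le> \<eta> * norm (1 :: real)"
      using eventually_g_lower_bound[OF assms \<eta>] eventually_gt_at_top[of 0]
    proof eventually_elim
      case (elim n)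
      then have "\<kappa> - \<eta> \<le> G n / ((real n)\<^sup>2 / 2)"
        by (simp add: \<kappa>_def G_def field_simps)
      then show ?case using \<eta> by (simp add: \<epsilon>_def min_def)
    qed
  qed
  moreover have "\<forall>\<^sub>F n in sequentially.
       n < ramsey_number (2 * l + 1) (nat \<lceil>c * real n\<rceil>) \<and>
       real (g_real n (real (2 * l + 1)) (c * real n)) \<ge> (\<kappa> + \<epsilon> n) * ((real n)\<^sup>2 / 2)"
    \<comment> \<open>Only the Ramsey condition is taken from this instance; positivity of
      \<open>n\<close> allows multiplying back by \<open>n\<^sup>2 / 2\<close>.\<close>
    using eventually_g_lower_bound[OF assms zero_less_one] eventually_gt_at_top[of 0]
  proof eventually_elim
    case (elim n)
    have "\<kappa> + \<epsilon> n \<le> G n / ((real n)\<^sup>2 / 2)" by (simp add: \<epsilon>_def)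
    then have "(\<kappa> + \<epsilon> n) * ((real n)\<^sup>2 / 2) \<le> G n / ((real n)\<^sup>2 / 2) * ((real n)\<^sup>2 / 2)"
      by (rule mult_right_mono) simp
    also have "\<dots> = G n" using elim by simp
    finally show ?case using elim G by simp
  qed
  ultimately show ?thesis unfolding \<kappa>_def by blast
qed

end
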